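(* Let $0<q<1$. The $q$-deformed Bargmann transform corresponding to the analytic case $m=0$, defined for $f\in\mathcal{H}_q=L^2(\mathcal{I}_q,d\xi)$ and $z\in\mathbb{C}_q$ by $$\mathcal{B}_0^q[f](z)=\int_{\mathcal{I}_q}\left(\prod_{k\ge0}\frac{1}{1-\sqrt2\,z\,\xi\,q^k(1-q)+z^2q^{2k}(1-q)}\right)\sqrt{\sqrt2\,\omega_q(\sqrt2\,\xi)}\;f(\xi)\,d\xi,$$ is an isometry $\mathcal{B}_0^q:\mathcal{H}_q\to\mathcal{A}^2(\mathbb{C}_q)$.
   Context: Notation: $(a;q)_n=\prod_{k=0}^{n-1}(1-aq^k)$ for $n\in\{0,1,\dots\}\cup\{\infty\}$; $[j]_q!=(q;q)_j/(1-q)^j$. Weight: $\omega_q(u)=\dfrac{(q;q)_\infty\sqrt{1-q}}{4\pi\sqrt{1-(1-q)u^2/4}}\prod_{k\ge0}\big(1+(2-u^2(1-q))q^k+q^{2k}\big)$. Interval: $\mathcal{I}_q=\left(-\frac{\sqrt2}{\sqrt{1-q}},\frac{\sqrt2}{\sqrt{1-q}}\right)$. Domain: $\mathbb{C}_q=\{z\in\mathbb{C}:(1-q)z\bar z<1\}$. Target space: $\mathcal{A}^2(\mathbb{C}_q)$ (the Arik–Coon space) is the Hilbert space of holomorphic functions on $\mathbb{C}_q$ for which the functions $h_j^{0,q}(z)=z^j/\sqrt{[j]_q!}$, $j\ge0$, form an orthonormal basis. Equivalently, it is the completion of the polynomials for $\langle\varphi,\phi\rangle=\int\varphi\,\overline{\phi}\,d\mu_q$,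 where $\mu_q=\sum_{j\ge0}\frac{q^j(q;q)_\infty}{(q;q)_j}\mu_j$ and $\mu_j$ is the normalized (total mass one) uniform measure on the circle $|z|=q^{j/2}(1-q)^{-1/2}$. *)

theory Defs
  imports "HOL-Complex_Analysis.Complex_Analysis"
begin

section \<open>$q$-notation\<close>

definition q_pochhammer :: "real \<Rightarrow> real \<Rightarrow> nat \<Rightarrow> real" where
  "q_pochhammer a q n = (\<Prod>k<n. 1 - a * q ^ k)"

definition q_pochhammer_inf :: "real \<Rightarrow> real \<Rightarrow> real" where
  "q_pochhammer_inf a q = (\<Prod>k. 1 - a * q ^ k)"

definition q_fact :: "real \<Rightarrow> nat \<Rightarrow> real" where
  "q_fact q j = q_pochhammer q q j / (1 - q) ^ j"

definition q_weight :: "real \<Rightarrow> real \<Rightarrow> real" where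
  "q_weight q u =
     q_pochhammer_inf q q * sqrt (1 - q) / (4 * pi * sqrt (1 - (1 - q) * u\<^sup>2 / 4))
       * (\<Prod>k. 1 + (2 - u\<^sup>2 * (1 - q)) * q ^ k + q ^ (2 * k))"

definition q_interval :: "real \<Rightarrow> real set" where
  "q_interval q = {- (sqrt 2 / sqrt (1 - q)) <..< sqrt 2 / sqrt (1 - q)}"

definition q_disc :: "real \<Rightarrow> complex set" where
  "q_disc q = {z. (1 - q) * (cmod z)\<^sup>2 < 1}"


section \<open>The space $L^2$ of the interval\<close>

text \<open>
  Elements of \<^term>\<open>L2_space q\<close> are representatives; \<^term>\<open>L2_norm q\<close> is a norm
  only modulo equality almost everywhere.
\<close>

definition L2_space :: "real \<Rightarrow> (real \<Rightarrow> complex) set" where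
  "L2_space q = {f. f \<in> borel_measurable (lebesgue_on (q_interval q)) \<and>
                    integrable (lebesgue_on (q_interval q)) (\<lambda>\<xi>. (cmod (f \<xi>))\<^sup>2)}"

definition L2_norm :: "real \<Rightarrow> (real \<Rightarrow> complex) \<Rightarrow> real" where
  "L2_norm q f = sqrt (\<integral>\<xi>. (cmod (f \<xi>))\<^sup>2 \<partial>lebesgue_on (q_interval q))"


section \<open>The Arik--Coon space\<close>

definition AC_basis :: "real \<Rightarrow> nat \<Rightarrow> complex \<Rightarrow> complex" where
  "AC_basis q j z = z ^ j / complex_of_real (sqrt (q_fact q j))"

text \<open>
  The Hilbert space of holomorphic functions on the disc with orthonormal basis
  \<^term>\<open>AC_basis q\<close>: its elements are the square-summable expansions in this basis, and the
  inner product is that of the coordinate sequences.  Functions are total, so elements of the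
  space are identified when they agree on \<^term>\<open>q_disc q\<close>; the values outside are irrelevant.
\<close>

definition AC_space :: "real \<Rightarrow> (complex \<Rightarrow> complex) set" where
  "AC_space q = {\<phi>. \<phi> holomorphic_on q_disc q \<and>
     (\<exists>c. summable (\<lambda>j. (cmod (c j))\<^sup>2) \<and>
          (\<forall>z\<in>q_disc q. (\<lambda>j. c j * AC_basis q j z) sums \<phi> z))}"

text \<open>The coordinates are unique, see \<open>AC_coord_eqI\<close> below.\<close>

definition AC_coord :: "real \<Rightarrow> (complex \<Rightarrow> complex) \<Rightarrow> nat \<Rightarrow> complex" where
  "AC_coord q \<phi> = (THE c. \<forall>z\<in>q_disc q. (\<lambda>j. c j * AC_basis q j z) sums \<phi> z)"

definition AC_inner :: "real \<Rightarrow> (complex \<Rightarrow> complex) \<Rightarrow> (complex \<Rightarrow> complex) \<Rightarrow> complex" where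
  "AC_inner q \<phi> \<psi> = (\<Sum>j. AC_coord q \<phi> j * cnj (AC_coord q \<psi> j))"

definition AC_norm :: "real \<Rightarrow> (complex \<Rightarrow> complex) \<Rightarrow> real" where
  "AC_norm q \<phi> = sqrt (Re (AC_inner q \<phi> \<phi>))"


section \<open>The $q$-deformed Bargmann transform\<close>

definition q_bargmann_kernel :: "real \<Rightarrow> complex \<Rightarrow> real \<Rightarrow> complex" where
  "q_bargmann_kernel q z \<xi> =
     (\<Prod>k. 1 / (1 - complex_of_real (sqrt 2) * z * complex_of_real \<xi>
                     * complex_of_real (q ^ k * (1 - q))
                  + z\<^sup>2 * complex_of_real (q ^ (2 * k) * (1 - q))))
     * complex_of_real (sqrt (sqrt 2 * q_weight q (sqrt 2 * \<xi>)))"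

definition q_bargmann :: "real \<Rightarrow> (real \<Rightarrow> complex) \<Rightarrow> complex \<Rightarrow> complex" where
  "q_bargmann q f z = (\<integral>\<xi>. q_bargmann_kernel q z \<xi> * f \<xi> \<partial>lebesgue_on (q_interval q))"


section \<open>Basic facts on the Arik--Coon space\<close>

lemma q_fact_pos:
  assumes "0 < q" "q < 1"
  shows "q_fact q j > 0"
proof -
  have "q * q ^ k < 1" for k
    using power_Suc_less_one[of q k] assms by simp
  then have "q_pochhammer q q j > 0"
    unfolding q_pochhammer_def by (intro prod_pos) simp
  then show ?thesis
    using assms by (simp add: q_fact_def)
qed

lemma q_fact_Suc:
  "q_fact q (Suc j) = q_fact q j * ((1 - q ^ Suc j) / (1 - q))"
  by (simp add: q_fact_def q_pochhammer_def)

lemma q_disc_eq_ball: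
  assumes "q < 1"
  shows "q_disc q = ball 0 (1 / sqrt (1 - q))"
proof -
  have "(1 - q) * (cmod z)\<^sup>2 < 1 \<longleftrightarrow> cmod z < 1 / sqrt (1 - q)" for z
  proof -
    have "(1 - q) * (cmod z)\<^sup>2 = (sqrt (1 - q) * cmod z)\<^sup>2"
      using assms by (simp add: power_mult_distrib)
    then have "(1 - q) * (cmod z)\<^sup>2 < 1 \<longleftrightarrow> sqrt (1 - q) * cmod z < 1"
      using assms by (simp add: abs_square_less_1 abs_mult)
    then show ?thesis
      using assms by (simp add: field_simps)
  qed
  then show ?thesis
    by (simp only: q_disc_def set_eq_iff mem_Collect_eq mem_ball dist_0_norm simp_thms)
qed

lemma AC_coord_unique:
  assumes q: "0 < q" "q < 1"
    and c: "\<And>z. z \<in> q_disc q \<Longrightarrow> (\<lambda>j. c j * AC_basis q j z) sums \<phi> z"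
    and d: "\<And>z. z \<in> q_disc q \<Longrightarrow> (\<lambda>j. d j * AC_basis q j z) sums \<phi> z"
  shows "c = d"
proof -
  define r where "r = 1 / sqrt (1 - q)"
  define a where "a j = (c j - d j) / complex_of_real (sqrt (q_fact q j))" for j
  have r: "r > 0" using q by (simp add: r_def)
  have s: "(\<lambda>j. a j * (z - 0) ^ j) sums 0" if "cmod (z - 0) < r" for z
  proof -
    have "z \<in> q_disc q" using that q by (simp add: q_disc_eq_ball r_def)
    from sums_diff[OF c[OF this] d[OF this]] show ?thesis
      by (simp add: a_def AC_basis_def algebra_simps diff_divide_distrib)
  qed
  have "a j = 0" for j
  proof (cases j)
    case 0
    have "(\<lambda>j. a j * 0 ^ j) sums 0" using s[of 0] r by simp
    then show ?thesis using 0 powser_sums_zero_iff by blast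
  next
    case (Suc k)
    show ?thesis
    proof (rule ccontr)
      assume nz: "a j \<noteq> 0"
      show False
      proof (rule powser_0_nonzero[where f = "\<lambda>_. 0" and \<xi> = 0 and m = j and a = a, OF r _ _ nz])
        show "(\<lambda>n. a n * (z - 0) ^ n) sums 0" if "cmod (z - 0) < r" for z
          by (rule s[OF that])
        show "0 < j" using Suc by simp
        show False if "0 < t" "\<And>z. (z::complex) \<in> cball 0 t - {0} \<Longrightarrow> (0::complex) \<noteq> 0" for t
          using that(2)[of "of_real t"] that(1) by simp
      qed simp
    qed
  qed
  then show ?thesis
    using q_fact_pos[OF q, THEN less_imp_neq] by (simp add: a_def fun_eq_iff)
qed

lemma AC_coord_eqI:
  assumes "0 < q" "q < 1"
    and "\<And>z. z \<in> q_disc q \<Longrightarrow> (\<lambda>j. c j * AC_basis q j z) sums \<phi> z"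
  shows "AC_coord q \<phi> = c"
  unfolding AC_coord_def using assms AC_coord_unique[OF assms(1,2)] by (intro the_equality) blast+

lemma AC_space_coord:
  assumes "0 < q" "q < 1" "\<phi> \<in> AC_space q"
  shows "summable (\<lambda>j. (cmod (AC_coord q \<phi> j))\<^sup>2)"
    and "z \<in> q_disc q \<Longrightarrow> (\<lambda>j. AC_coord q \<phi> j * AC_basis q j z) sums \<phi> z"
proof -
  obtain c where "summable (\<lambda>j. (cmod (c j))\<^sup>2)"
      "\<And>z. z \<in> q_disc q \<Longrightarrow> (\<lambda>j. c j * AC_basis q j z) sums \<phi> z"
    using assms(3) by (auto simp: AC_space_def)
  moreover from this have "AC_coord q \<phi> = c" using AC_coord_eqI assms by blast
  ultimately show "summable (\<lambda>j. (cmod (AC_coord q \<phi> j))\<^sup>2)"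
    and "z \<in> q_disc q \<Longrightarrow> (\<lambda>j. AC_coord q \<phi> j * AC_basis q j z) sums \<phi> z" by auto
qed

lemma AC_norm_sq:
  assumes "0 < q" "q < 1" "\<phi> \<in> AC_space q"
  shows "(AC_norm q \<phi>)\<^sup>2 = (\<Sum>j. (cmod (AC_coord q \<phi> j))\<^sup>2)"
proof -
  have s: "summable (\<lambda>j. (cmod (AC_coord q \<phi> j))\<^sup>2)" using AC_space_coord[OF assms] by blast
  have "AC_inner q \<phi> \<phi> = (\<Sum>j. complex_of_real ((cmod (AC_coord q \<phi> j))\<^sup>2))"
    unfolding AC_inner_def complex_norm_square ..
  also have "\<dots> = complex_of_real (\<Sum>j. (cmod (AC_coord q \<phi> j))\<^sup>2)"
    using s by (simp only: suminf_of_real)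
  finally show ?thesis
    by (simp add: AC_norm_def suminf_nonneg[OF s])
qed

lemma AC_coord_basis:
  assumes "0 < q" "q < 1"
  shows "AC_coord q (AC_basis q i) = (\<lambda>j. if j = i then 1 else 0)"
proof (rule AC_coord_eqI[OF assms])
  fix z
  have "(\<lambda>j. if j = i then AC_basis q j z else 0) sums AC_basis q i z"
    by (rule sums_single)
  moreover have "(\<lambda>j. if j = i then AC_basis q j z else 0) =
      (\<lambda>j. (if j = i then 1 else 0) * AC_basis q j z)" by auto
  ultimately show "(\<lambda>j. (if j = i then 1 else 0) * AC_basis q j z) sums AC_basis q i z" by simp
qed

lemma AC_basis_in_AC_space:
  assumes "0 < q" "q < 1"
  shows "AC_basis q i \<in> AC_space q"
proof -
  have "AC_basis q i holomorphic_on q_disc q"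
    using q_fact_pos[OF assms, of i] unfolding AC_basis_def by (intro holomorphic_intros) auto
  moreover have "summable (\<lambda>j. (cmod (if j = i then 1 else 0))\<^sup>2)"
    by (rule summable_finite[of "{i}"]) auto
  moreover have "(\<lambda>j. (if j = i then 1 else 0) * AC_basis q j z) sums AC_basis q i z" for z
    using sums_single[of i "\<lambda>j. AC_basis q j z"] by (simp add: if_distrib[of "\<lambda>x. x * _"] cong: if_cong)
  ultimately show ?thesis
    unfolding AC_space_def by (auto intro!: exI[of _ "\<lambda>j. if j = i then 1 else 0"])
qed

lemma AC_basis_orthonormal:
  assumes "0 < q" "q < 1"
  shows "AC_inner q (AC_basis q i) (AC_basis q j) = (if i = j then 1 else 0)"
proof -
  have "AC_inner q (AC_basis q i) (AC_basis q j) =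
      (\<Sum>n. if n = i then (if i = j then 1 else 0) else 0)"
    unfolding AC_inner_def AC_coord_basis[OF assms] by (intro suminf_cong) auto
  also have "\<dots> = (if i = j then 1 else 0)"
    using sums_unique[OF sums_single[of i "\<lambda>_. (if i = j then 1 else 0 :: complex)"]] by simp
  finally show ?thesis .
qed

lemma summable_AC_basis_sq:
  assumes q: "0 < q" "q < 1" and z: "z \<in> q_disc q"
  shows "summable (\<lambda>j. (cmod (AC_basis q j z))\<^sup>2)"
proof -
  define t where "t = (1 - q) * (cmod z)\<^sup>2"
  have t: "0 \<le> t" "t < 1" using q z by (auto simp: t_def q_disc_def)
  have eq: "(cmod (AC_basis q j z))\<^sup>2 = (cmod z)\<^sup>2 ^ j / q_fact q j" for j
    using q_fact_pos[OF q, of j]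
    by (simp add: AC_basis_def norm_divide norm_power power_divide flip: power_mult)
       (simp add: mult.commute)
  have "(\<lambda>j. t / (1 - q ^ Suc j)) \<longlonglongrightarrow> t / (1 - 0)"
    by (intro tendsto_intros LIMSEQ_Suc LIMSEQ_power_zero) (use q in auto)
  moreover have "t / (1 - 0) < (t + 1) / 2" using t by simp
  ultimately have "eventually (\<lambda>j. t / (1 - q ^ Suc j) < (t + 1) / 2) sequentially"
    by (rule order_tendstoD)
  then obtain N where N: "\<And>j. j \<ge> N \<Longrightarrow> t / (1 - q ^ Suc j) < (t + 1) / 2"
    by (auto simp: eventually_sequentially)
  show ?thesis
  proof (rule summable_ratio_test[of "(t + 1) / 2" N])
    show "(t + 1) / 2 < 1" using t by simp
    fix j assume "N \<le> j"
    have "(cmod (AC_basis q (Suc j) z))\<^sup>2 = t / (1 - q ^ Suc j) * (cmod (AC_basis q j z))\<^sup>2"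
      by (simp add: eq q_fact_Suc t_def field_simps)
    also have "\<dots> \<le> (t + 1) / 2 * (cmod (AC_basis q j z))\<^sup>2"
      using N[OF \<open>N \<le> j\<close>] by (intro mult_right_mono) auto
    finally show "norm ((cmod (AC_basis q (Suc j) z))\<^sup>2)
        \<le> (t + 1) / 2 * norm ((cmod (AC_basis q j z))\<^sup>2)" by simp
  qed
qed

text \<open>
  Together with uniqueness of coordinates: \<^term>\<open>AC_coord q\<close> maps the space onto all
  square-summable sequences, so the space is complete.
\<close>

lemma AC_space_exists:
  assumes q: "0 < q" "q < 1" and c: "summable (\<lambda>j. (cmod (c j))\<^sup>2)"
  shows "\<exists>\<phi>\<in>AC_space q. AC_coord q \<phi> = c"
proof -
  define \<phi> where "\<phi> z = (\<Sum>j. c j * AC_basis q j z)" for z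
  have s: "(\<lambda>j. c j * AC_basis q j z) sums \<phi> z" if z: "z \<in> q_disc q" for z
  proof -
    have "summable (\<lambda>j. c j * AC_basis q j z)"
    proof (rule summable_comparison_test)
      show "summable (\<lambda>j. (cmod (c j))\<^sup>2 + (cmod (AC_basis q j z))\<^sup>2)"
        by (intro summable_add c summable_AC_basis_sq q z)
      have "x * y \<le> x\<^sup>2 + y\<^sup>2" if "x \<ge> 0" "y \<ge> 0" for x y :: real
        using sum_squares_bound[of x y] mult_nonneg_nonneg[OF that] by linarith
      then show "\<exists>N. \<forall>j\<ge>N. norm (c j * AC_basis q j z)
          \<le> (cmod (c j))\<^sup>2 + (cmod (AC_basis q j z))\<^sup>2"
        by (simp add: norm_mult)
    qed
    then show ?thesis unfolding \<phi>_def by (rule summable_sums)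
  qed
  have "\<phi> holomorphic_on q_disc q"
    unfolding q_disc_eq_ball[OF q(2)]
  proof (rule power_series_holomorphic)
    fix w :: complex assume "w \<in> ball 0 (1 / sqrt (1 - q))"
    then have "(\<lambda>j. c j * AC_basis q j w) sums \<phi> w"
      using s q by (simp add: q_disc_eq_ball)
    then show "(\<lambda>j. c j / complex_of_real (sqrt (q_fact q j)) * (w - 0) ^ j) sums \<phi> w"
      by (simp add: AC_basis_def)
  qed
  then have "\<phi> \<in> AC_space q" using s c by (auto simp: AC_space_def)
  then show ?thesis using AC_coord_eqI[OF q s] by blast
qed

end

theory Submission
  imports Defs
begin

text \<open>
  In the variable \<open>x = sqrt (1 - q) / sqrt 2 * \<xi>\<close>, which runs through \<open>(-1, 1)\<close>, and with
  \<open>t = sqrt (1 - q) * z\<close>, the infinite product in the kernel is the generating function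
  \<open>\<Prod>k. 1 / (1 - 2 x t q^k + t^2 q^(2k)) = \<Sum>n. H n x * t^n / (q;q)_n\<close> of the continuous
  \<open>q\<close>-Hermite polynomials \<open>H n\<close>.  The weight under the square root in the kernel is exactly the
  probability density on the interval for which \<open>H m\<close> and \<open>H n\<close> have inner product
  \<open>(q;q)_n\<close> if \<open>m = n\<close> and \<open>0\<close> otherwise.  Hence the kernel equals
  \<open>\<Sum>n. hermite_fun q n \<xi> * AC_basis q n z\<close> with \<open>hermite_fun q\<close> orthonormal in the \<open>L^2\<close> space
  of the interval, and the transform sends the Fourier coefficients of \<open>f\<close> with respect to this
  system to coordinates in the Arik--Coon space.  It is an isometry because the system is complete.

  Three facts carry the argument.

  The generating function (\<open>q_hermite_generating_function\<close>) is the Cauchy product of two copies of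
  Euler's series \<open>\<Sum>n. u^n / (q;q)_n = 1 / (u;q)_\<infinity>\<close>, at \<open>u = t e^(i\<theta>)\<close> and \<open>u = t e^(-i\<theta>)\<close>, where
  \<open>x = cos \<theta>\<close>.

  Orthonormality (\<open>q_hermite_orthogonal\<close>) reduces, through the three-term recurrence, to the
  statement that the weight integrates \<open>H n\<close> to \<open>0\<close> for \<open>n > 0\<close> and \<open>1\<close> to \<open>1\<close>.  After the
  substitution \<open>x = cos \<theta>\<close> one needs the Fourier coefficients of the theta-like product
  \<open>\<Prod>k. (1 - u q^k) (1 - q^k / u)\<close>, \<open>u = e^(2i\<theta>)\<close>.  For the partial products they are given by the
  finite Jacobi triple product, itself a rewriting of the \<open>q\<close>-binomial theorem; passing to the
  limit, the integral of \<open>H (2m)\<close> becomes an alternating sum that the \<open>q\<close>-binomial theorem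
  evaluates as a product with a vanishing factor.

  Completeness (\<open>hermite_fun_dense\<close>) follows from density of the polynomials in the \<open>L^2\<close> space of
  a finite measure on a bounded interval: truncate, approximate almost everywhere by continuous
  functions, apply Weierstrass.  Bessel's identity then turns density into Parseval's equation.
\<close>

section \<open>Reciprocal q-factorials and the q-binomial theorem\<close>

definition euler_coeff :: "real \<Rightarrow> nat \<Rightarrow> real" where
  "euler_coeff q n = 1 / q_pochhammer q q n"

text \<open>
  \<open>(-1)^k q^(k(k-1)/2)\<close>, the coefficients of the Jacobi theta series.  Negative \<open>k\<close> are needed, since
  Fourier coefficients of both signs occur.
\<close>

definition theta_coeff :: "real \<Rightarrow> int \<Rightarrow> real" where
  "theta_coeff q k = (-1) powi k * q powi (k * (k - 1) div 2)"

lemma q_power_Suc_less_1: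
  fixes q :: real assumes "0 < q" "q < 1" shows "q ^ Suc n < 1"
  using power_Suc_less_one[of q n] assms by simp

lemma euler_coeff_0 [simp]: "euler_coeff q 0 = 1"
  by (simp add: euler_coeff_def q_pochhammer_def)

lemma euler_coeff_Suc:
  assumes "0 < q" "q < 1"
  shows "(1 - q ^ Suc n) * euler_coeff q (Suc n) = euler_coeff q n"
  using q_power_Suc_less_1[OF assms, of n] by (simp add: euler_coeff_def q_pochhammer_def)

lemma sum_atMost_Suc_if_zero:
  fixes f :: "nat \<Rightarrow> 'a::comm_ring_1"
  assumes "f 0 = 0" shows "(\<Sum>a\<le>Suc n. f a) = (\<Sum>a\<le>n. f (Suc a))"
  using assms by (simp only: sum.atMost_Suc_shift) simp

text \<open>
  The exponent \<open>k(k-1)/2\<close> is quadratic with polar form \<open>i j\<close>.  This is what allows an index shift in a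
  theta-type sum to be absorbed into a rescaling of the variable.
\<close>

lemma theta_coeff_add:
  assumes "q > 0"
  shows "theta_coeff q (i + j) = theta_coeff q i * theta_coeff q j * q powi (i * j)"
proof -
  have "(i + j) * (i + j - 1) = i * (i - 1) + j * (j - 1) + 2 * (i * j)"
    by (simp add: algebra_simps)
  moreover have "even (i * (i - 1))" "even (j * (j - 1))" by auto
  ultimately have "(i + j) * (i + j - 1) div 2 = i * (i - 1) div 2 + j * (j - 1) div 2 + i * j"
    by (auto elim!: evenE)
  then show ?thesis
    using assms by (simp add: theta_coeff_def power_int_add)
qed

lemma theta_coeff_0 [simp]: "theta_coeff q 0 = 1"
  by (simp add: theta_coeff_def)

lemma theta_coeff_1 [simp]: "theta_coeff q 1 = -1"
  by (simp add: theta_coeff_def)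

lemma theta_coeff_Suc:
  assumes "q > 0"
  shows "theta_coeff q (int (Suc n)) = - (q ^ n) * theta_coeff q (int n)"
  using theta_coeff_add[OF assms, of "int n" 1] by (simp add: add.commute)

text \<open>
  The Gauss--Rothe form \<open>\<Sum>a. [n choose a]_q (-1)^a q^(a(a-1)/2) x^a = \<Prod>k<n. 1 - x q^k\<close>, divided by
  \<open>(q;q)_n\<close> so that the \<open>q\<close>-binomial coefficient splits into \<open>euler_coeff q a * euler_coeff q (n - a)\<close>.
\<close>

lemma q_binomial_theorem:
  fixes x :: "'a::real_normed_field"
  assumes q: "0 < q" "q < 1"
  shows "(\<Sum>a\<le>n. of_real (euler_coeff q a * euler_coeff q (n - a) * theta_coeff q (int a)) * x ^ a)
       = of_real (euler_coeff q n) * (\<Prod>k<n. 1 - x * of_real (q ^ k))"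
proof (induction n)
  case (Suc n)
  define t where "t a = of_real (euler_coeff q a * euler_coeff q (Suc n - a) * theta_coeff q (int a)) * x ^ a" for a
  define B where "B = (\<Sum>a\<le>n. of_real (euler_coeff q a * euler_coeff q (n - a) * theta_coeff q (int a)) * x ^ a)"
  \<comment> \<open>Pascal's rule: the first summand lowers the factor with index \<open>Suc n - a\<close>, the second the one with index \<open>a\<close>\<close>
  have split: "1 - q ^ Suc n = (1 - q ^ (Suc n - a)) + q ^ (Suc n - a) * (1 - q ^ a)"
    if "a \<le> Suc n" for a
    using that by (simp add: algebra_simps flip: power_add power_Suc)
  have 1: "(\<Sum>a\<le>Suc n. of_real (1 - q ^ (Suc n - a)) * t a) = B"
  proof -
    have "of_real (1 - q ^ (Suc n - a)) * t a
        = of_real (euler_coeff q a * euler_coeff q (n - a) * theta_coeff q (int a)) * x ^ a" if "a \<le> n" for a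
    proof -
      have *: "euler_coeff q (n - a) = (1 - q ^ (Suc n - a)) * euler_coeff q (Suc n - a)"
        using euler_coeff_Suc[OF q, of "n - a"] that by (simp add: Suc_diff_le)
      have **: "(1 - q ^ (Suc n - a)) * (euler_coeff q a * euler_coeff q (Suc n - a) * theta_coeff q (int a))
          = euler_coeff q a * euler_coeff q (n - a) * theta_coeff q (int a)"
        unfolding * by (simp only: mult_ac)
      show ?thesis unfolding t_def mult.assoc[symmetric, of _ "of_real _" "x ^ a"] of_real_mult[symmetric] ** ..
    qed
    then show ?thesis by (simp add: B_def)
  qed
  have 2: "(\<Sum>a\<le>Suc n. of_real (q ^ (Suc n - a) * (1 - q ^ a)) * t a) = - x * of_real (q ^ n) * B"
  proof -
    have "of_real (q ^ (Suc n - Suc a) * (1 - q ^ Suc a)) * t (Suc a)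
        = - x * of_real (q ^ n) *
          (of_real (euler_coeff q a * euler_coeff q (n - a) * theta_coeff q (int a)) * x ^ a)" if "a \<le> n" for a
    proof -
      have n: "q ^ n = q ^ (n - a) * q ^ a" using that by (simp flip: power_add)
      have "q ^ (Suc n - Suc a) * (1 - q ^ Suc a) * (euler_coeff q (Suc a) * euler_coeff q (Suc n - Suc a) * theta_coeff q (int (Suc a)))
          = q ^ (n - a) * ((1 - q ^ Suc a) * euler_coeff q (Suc a)) * euler_coeff q (n - a) * (- (q ^ a) * theta_coeff q (int a))"
        unfolding theta_coeff_Suc[OF q(1)] by simp
      also have "\<dots> = - (q ^ n) * (euler_coeff q a * euler_coeff q (n - a) * theta_coeff q (int a))"
        unfolding euler_coeff_Suc[OF q] n by simp
      finally have *: "of_real (q ^ (Suc n - Suc a) * (1 - q ^ Suc a)) * (of_real (euler_coeff q (Suc a) * euler_coeff q (Suc n - Suc a) * theta_coeff q (int (Suc a))) :: 'a)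
         = of_real (- (q ^ n) * (euler_coeff q a * euler_coeff q (n - a) * theta_coeff q (int a)))"
        by (simp only: of_real_mult[symmetric])
      show ?thesis unfolding t_def mult.assoc[symmetric] * by simp
    qed
    then show ?thesis
      by (subst sum_atMost_Suc_if_zero) (simp_all add: B_def sum_distrib_left)
  qed
  have "of_real (1 - q ^ Suc n) * (\<Sum>a\<le>Suc n. t a)
      = (\<Sum>a\<le>Suc n. of_real (1 - q ^ (Suc n - a)) * t a)
        + (\<Sum>a\<le>Suc n. of_real (q ^ (Suc n - a) * (1 - q ^ a)) * t a)"
    unfolding sum_distrib_left sum.distrib[symmetric]
    by (intro sum.cong refl) (simp only: split of_real_add distrib_right atMost_iff)
  also have "\<dots> = (1 - x * of_real (q ^ n)) * B"
    unfolding 1 2 by (simp add: algebra_simps)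
  also have "\<dots> = of_real (1 - q ^ Suc n) * (of_real (euler_coeff q (Suc n)) * (\<Prod>k<Suc n. 1 - x * of_real (q ^ k)))"
    unfolding mult.assoc[symmetric] of_real_mult[symmetric] euler_coeff_Suc[OF q]
    using Suc by (simp add: B_def mult_ac)
  finally have "of_real (1 - q ^ Suc n) * ((\<Sum>a\<le>Suc n. t a) - of_real (euler_coeff q (Suc n)) * (\<Prod>k<Suc n. 1 - x * of_real (q ^ k))) = 0"
    by (simp only: right_diff_distrib diff_self)
  then have "(\<Sum>a\<le>Suc n. t a) - of_real (euler_coeff q (Suc n)) * (\<Prod>k<Suc n. 1 - x * of_real (q ^ k)) = 0"
    using q_power_Suc_less_1[OF q, of n] unfolding mult_eq_0_iff of_real_eq_0_iff by auto
  then show ?case unfolding t_def by (simp only: right_minus_eq)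
qed simp

text \<open>
  By \<open>theta_coeff_add\<close> the shift by \<open>s\<close> turns this into the \<open>q\<close>-binomial sum at \<open>x = q^(-s)\<close>, and the
  factor \<open>1 - x q^s\<close> of the product is zero.  It is the source of all orthogonality below.
\<close>

lemma theta_sum_vanishes:
  assumes q: "0 < q" "q < 1" and s: "0 \<le> s" "s < int n"
  shows "(\<Sum>a\<le>n. euler_coeff q a * euler_coeff q (n - a) * theta_coeff q (int a - s)) = 0"
proof -
  have "euler_coeff q a * euler_coeff q (n - a) * theta_coeff q (int a - s) =
      theta_coeff q (- s) * (euler_coeff q a * euler_coeff q (n - a) * theta_coeff q (int a) * (q powi (- s)) ^ a)" for a
  proof -
    have "q powi (int a * - s) = (q powi (- s)) ^ a"
      by (subst mult.commute) (simp only: power_int_mult power_int_of_nat)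
    then show ?thesis using theta_coeff_add[OF q(1), of "int a" "- s"] by simp
  qed
  then have "(\<Sum>a\<le>n. euler_coeff q a * euler_coeff q (n - a) * theta_coeff q (int a - s)) =
     theta_coeff q (- s) * (euler_coeff q n * (\<Prod>k<n. 1 - q powi (- s) * q ^ k))"
    using q_binomial_theorem[OF q, of n "q powi (- s)"] by (simp only: of_real_eq_id id_apply flip: sum_distrib_left)
  moreover have "(\<Prod>k<n. 1 - q powi (- s) * q ^ k) = 0"
  proof (rule prod_zero)
    have "q powi (- s) * q ^ nat s = 1"
      using s q by (simp add: power_int_def field_simps)
    then show "\<exists>k\<in>{..<n}. 1 - q powi (- s) * q ^ k = 0"
      using s by (intro bexI[of _ "nat s"]) auto
  qed simp
  ultimately show ?thesis by simp
qed

section \<open>Continuous q-Hermite polynomials\<close>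

text \<open>
  The continuous \<open>q\<close>-Hermite polynomial \<open>H n\<close> divided by \<open>(q;q)_n\<close>.  In this normalization the
  generating function has no denominators and the trigonometric form is a plain convolution.
\<close>

fun q_hermite :: "real \<Rightarrow> nat \<Rightarrow> real \<Rightarrow> real" where
  "q_hermite q 0 x = 1"
| "q_hermite q (Suc 0) x = 2 * x / (1 - q)"
| "q_hermite q (Suc (Suc n)) x =
     (2 * x * q_hermite q (Suc n) x - q_hermite q n x) / (1 - q ^ Suc (Suc n))"

lemma q_hermite_recurrence:
  assumes "0 < q" "q < 1"
  shows "(1 - q ^ Suc (Suc n)) * q_hermite q (Suc (Suc n)) x = 2 * x * q_hermite q (Suc n) x - q_hermite q n x"
  using q_power_Suc_less_1[OF assms, of "Suc n"] by simp

text \<open>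
  For \<open>z = e^(i\<theta>)\<close> this is the Fourier expansion in \<open>\<theta>\<close>.  The convolution on the right satisfies the
  three-term recurrence because multiplying by \<open>1 - q^n\<close> can be distributed over the two factors.
\<close>

lemma q_hermite_trig:
  assumes q: "0 < q" "q < 1" and z: "z \<noteq> 0" "z + 1 / z = 2 * of_real x"
  shows "of_real (q_hermite q n x) =
     (\<Sum>a\<le>n. (of_real (euler_coeff q a) * z ^ a) * (of_real (euler_coeff q (n - a)) * (1 / z) ^ (n - a) :: complex))"
    (is "_ = (\<Sum>a\<le>n. ?E a * ?F (n - a))")
proof -
  define A where "A n = (\<Sum>a\<le>n. ?E a * ?F (n - a))" for n
  have E: "of_real (1 - q ^ Suc a) * ?E (Suc a) = z * ?E a" for a
    unfolding mult.assoc[symmetric] of_real_mult[symmetric] euler_coeff_Suc[OF q] by simp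
  have F: "of_real (1 - q ^ Suc a) * ?F (Suc a) = 1 / z * ?F a" for a
    unfolding mult.assoc[symmetric] of_real_mult[symmetric] euler_coeff_Suc[OF q] by simp
  have s1: "(\<Sum>a\<le>Suc n. of_real (1 - q ^ a) * ?E a * G (Suc n - a)) = z * (\<Sum>a\<le>n. ?E a * G (n - a))" for n G
    by (subst sum_atMost_Suc_if_zero) (simp_all only: E sum_distrib_left mult.assoc diff_Suc_Suc power_0 diff_self of_real_0 mult_zero_left)
  have s2: "(\<Sum>a\<le>Suc n. G a * (of_real (1 - q ^ (Suc n - a)) * ?F (Suc n - a))) = 1 / z * (\<Sum>a\<le>n. G a * ?F (n - a))" for n and G :: "nat \<Rightarrow> complex"
  proof -
    have "(\<Sum>a\<le>Suc n. G a * (of_real (1 - q ^ (Suc n - a)) * ?F (Suc n - a)))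
        = (\<Sum>a\<le>n. G a * (of_real (1 - q ^ (Suc n - a)) * ?F (Suc n - a)))" by simp
    also have "\<dots> = (\<Sum>a\<le>n. G a * (1 / z * ?F (n - a)))"
      by (intro sum.cong refl) (simp only: F Suc_diff_le atMost_iff)
    finally show ?thesis by (simp add: sum_distrib_left mult_ac)
  qed
  \<comment> \<open>\<open>1 - x y = (1 - x) + (1 - y) - (1 - x) (1 - y)\<close> for \<open>x = q^a\<close>, \<open>y = q^(n - a)\<close>; the three parts give
      \<open>z * A (n - 1)\<close>, \<open>A (n - 1) / z\<close> and \<open>A (n - 2)\<close>\<close>
  have split: "of_real (1 - q ^ n) = of_real (1 - q ^ a) + of_real (1 - q ^ (n - a)) - of_real (1 - q ^ a) * (of_real (1 - q ^ (n - a)) :: complex)"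
    if "a \<le> n" for a n
  proof -
    have "1 - q ^ n = (1 - q ^ a) + (1 - q ^ (n - a)) - (1 - q ^ a) * (1 - q ^ (n - a))"
      using that by (simp add: algebra_simps flip: power_add)
    then show ?thesis by (metis of_real_add of_real_diff of_real_mult)
  qed
  have rec: "of_real (1 - q ^ n) * A n = (\<Sum>a\<le>n. of_real (1 - q ^ a) * ?E a * ?F (n - a))
      + (\<Sum>a\<le>n. ?E a * (of_real (1 - q ^ (n - a)) * ?F (n - a)))
      - (\<Sum>a\<le>n. of_real (1 - q ^ a) * ?E a * (of_real (1 - q ^ (n - a)) * ?F (n - a)))" for n
  proof -
    have "of_real (1 - q ^ n) * (?E a * ?F (n - a)) = of_real (1 - q ^ a) * ?E a * ?F (n - a)
        + ?E a * (of_real (1 - q ^ (n - a)) * ?F (n - a))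
        - of_real (1 - q ^ a) * ?E a * (of_real (1 - q ^ (n - a)) * ?F (n - a))" if "a \<le> n" for a
      unfolding split[OF that] by (simp add: algebra_simps)
    then show ?thesis unfolding A_def sum_distrib_left sum.distrib[symmetric] sum_subtractf[symmetric]
      by (intro sum.cong refl) auto
  qed
  have A0: "A 0 = 1" by (simp add: A_def)
  have A1: "of_real (1 - q) * A (Suc 0) = 2 * of_real x"
  proof -
    have "(1 - q) * euler_coeff q (Suc 0) = 1" using euler_coeff_Suc[OF q, of 0] by simp
    then have "of_real (1 - q) * complex_of_real (euler_coeff q (Suc 0)) = 1"
      by (simp only: of_real_mult[symmetric] of_real_1)
    then show ?thesis
      unfolding z(2)[symmetric] by (simp add: A_def distrib_left flip: mult.assoc del: of_real_diff)
  qed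
  have A2: "of_real (1 - q ^ Suc (Suc n)) * A (Suc (Suc n)) = 2 * of_real x * A (Suc n) - A n" for n
  proof -
    have "(\<Sum>a\<le>Suc (Suc n). of_real (1 - q ^ a) * ?E a * ?F (Suc (Suc n) - a)) = z * A (Suc n)"
      unfolding A_def by (rule s1)
    moreover have "(\<Sum>a\<le>Suc (Suc n). ?E a * (of_real (1 - q ^ (Suc (Suc n) - a)) * ?F (Suc (Suc n) - a))) = 1 / z * A (Suc n)"
      unfolding A_def by (rule s2)
    moreover have "(\<Sum>a\<le>Suc (Suc n). of_real (1 - q ^ a) * ?E a * (of_real (1 - q ^ (Suc (Suc n) - a)) * ?F (Suc (Suc n) - a))) = z * (1 / z * A n)"
      unfolding A_def s2 s1[where n = n and G = ?F] by (rule mult.left_commute)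
    ultimately show ?thesis
      unfolding rec z(2)[symmetric] using z(1) by (simp add: distrib_right)
  qed
  have nz: "of_real (1 - q ^ Suc n) \<noteq> (0::complex)" for n
    using q_power_Suc_less_1[OF q, of n] unfolding of_real_eq_0_iff by auto
  have "of_real (q_hermite q n x) = A n \<and> of_real (q_hermite q (Suc n) x) = A (Suc n)"
  proof (induction n)
    case 0
    have "of_real (1 - q) * of_real (q_hermite q (Suc 0) x) = of_real (1 - q) * A (Suc 0)"
      unfolding A1 of_real_mult[symmetric] using q by simp
    then show ?case using nz[of 0] by (simp add: A0 del: of_real_diff q_hermite.simps(2))
  next
    case (Suc n)
    have "of_real (1 - q ^ Suc (Suc n)) * of_real (q_hermite q (Suc (Suc n)) x)
        = of_real (1 - q ^ Suc (Suc n)) * A (Suc (Suc n))"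
      unfolding of_real_mult[symmetric] q_hermite_recurrence[OF q] A2 using Suc by simp
    then show ?case using nz[of "Suc n"] Suc unfolding mult_cancel_left by auto
  qed
  then show ?thesis by (simp add: A_def)
qed

section \<open>Euler's product and the generating function\<close>

lemma q_pochhammer_pos: "0 < q \<Longrightarrow> q < 1 \<Longrightarrow> q_pochhammer q q n > 0"
  unfolding q_pochhammer_def using q_power_Suc_less_1[of q] by (intro prod_pos) simp

lemma euler_coeff_pos: "0 < q \<Longrightarrow> q < 1 \<Longrightarrow> euler_coeff q n > 0"
  by (simp add: euler_coeff_def q_pochhammer_pos)

lemma summable_imp_prodinf_LIMSEQ_pos:
  fixes f :: "nat \<Rightarrow> real"
  assumes "summable (\<lambda>k. \<bar>f k - 1\<bar>)" and pos: "\<And>k. f k > 0"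
  shows "(\<lambda>n. \<Prod>k<n. f k) \<longlonglongrightarrow> prodinf f" "prodinf f > 0"
proof -
  have "convergent_prod f"
    using assms by (intro abs_convergent_prod_imp_convergent_prod summable_imp_abs_convergent_prod) simp
  then show "(\<lambda>n. \<Prod>k<n. f k) \<longlonglongrightarrow> prodinf f"
    by (simp add: LIMSEQ_lessThan_iff_atMost convergent_prod_LIMSEQ)
  show "prodinf f > 0"
    using \<open>convergent_prod f\<close> pos by (blast intro: has_prod_pos)
qed

lemma q_pochhammer_LIMSEQ:
  assumes q: "0 < q" "q < 1"
  shows "(\<lambda>n. q_pochhammer q q n) \<longlonglongrightarrow> q_pochhammer_inf q q" "q_pochhammer_inf q q > 0"
proof -
  have "summable (\<lambda>k. \<bar>1 - q * q ^ k - 1\<bar>)"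
    using q by (auto simp: abs_mult intro!: summable_mult summable_geometric)
  moreover have "1 - q * q ^ k > 0" for k
    using q_power_Suc_less_1[OF q, of k] by simp
  ultimately show "(\<lambda>n. q_pochhammer q q n) \<longlonglongrightarrow> q_pochhammer_inf q q" "q_pochhammer_inf q q > 0"
    unfolding q_pochhammer_def q_pochhammer_inf_def by (rule summable_imp_prodinf_LIMSEQ_pos)+
qed

lemma euler_coeff_LIMSEQ:
  assumes q: "0 < q" "q < 1"
  shows "euler_coeff q \<longlonglongrightarrow> 1 / q_pochhammer_inf q q"
  unfolding euler_coeff_def using q_pochhammer_LIMSEQ[OF q] by (intro tendsto_intros) auto

lemma euler_coeff_le:
  assumes q: "0 < q" "q < 1"
  shows "euler_coeff q n \<le> 1 / q_pochhammer_inf q q"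
proof (rule incseq_le[OF _ euler_coeff_LIMSEQ[OF q]])
  have "euler_coeff q n \<le> euler_coeff q (Suc n)" for n
    using euler_coeff_Suc[OF q, of n] euler_coeff_pos[OF q, of "Suc n"] q
      mult_right_mono[of "1 - q ^ Suc n" 1 "euler_coeff q (Suc n)"] by simp
  then show "incseq (euler_coeff q)" by (rule incseq_SucI)
qed

lemma summable_euler:
  fixes u :: complex
  assumes q: "0 < q" "q < 1" and u: "norm u < 1"
  shows "summable (\<lambda>n. norm (of_real (euler_coeff q n) * u ^ n))"
proof (rule summable_comparison_test)
  show "summable (\<lambda>n. 1 / q_pochhammer_inf q q * norm u ^ n)"
    using u by (intro summable_mult summable_geometric) simp
  show "\<exists>N. \<forall>n\<ge>N. norm (norm (of_real (euler_coeff q n) * u ^ n)) \<le> 1 / q_pochhammer_inf q q * norm u ^ n"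
    using mult_right_mono[OF euler_coeff_le[OF q], of "norm u ^ _"] less_imp_le[OF euler_coeff_pos[OF q]]
    by (auto simp: norm_mult norm_power abs_of_nonneg)
qed

text \<open>
  With \<open>E u\<close> the sum of the series, comparison of coefficients gives \<open>E (q u) = (1 - u) * E u\<close>.  Iterating,
  \<open>E u\<close> times the partial product is \<open>E (q^N u)\<close>, which tends to \<open>E 0 = 1\<close>.  In particular
  \<open>E u\<close> cannot vanish.
\<close>

lemma euler_product:
  fixes u :: complex
  assumes q: "0 < q" "q < 1" and u: "norm u < 1"
  shows "(\<lambda>N. \<Prod>k<N. 1 - u * of_real (q ^ k)) \<longlonglongrightarrow> 1 / (\<Sum>n. of_real (euler_coeff q n) * u ^ n)"
    and "(\<Sum>n. of_real (euler_coeff q n) * u ^ n) \<noteq> 0"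
proof -
  define E where "E u = (\<Sum>n. complex_of_real (euler_coeff q n) * u ^ n)" for u
  have E: "(\<lambda>n. of_real (euler_coeff q n) * u ^ n) sums E u" if "norm u < 1" for u
    unfolding E_def by (rule summable_sums[OF summable_norm_cancel[OF summable_euler[OF q that]]])
  have step: "E (u * of_real q) = (1 - u) * E u" if u: "norm u < 1" for u
  proof -
    have u': "norm (u * of_real q) < 1"
      using u q mult_strict_mono[of "norm u" 1 q 1] by (simp add: norm_mult)
    have "(\<lambda>n. of_real (euler_coeff q (Suc n)) * u ^ Suc n - of_real (euler_coeff q (Suc n)) * (u * of_real q) ^ Suc n) sums (E u - 1 - (E (u * of_real q) - 1))"
      using E[OF u] E[OF u'] by (intro sums_diff) (subst sums_Suc_iff, simp)+
    moreover have "of_real (euler_coeff q (Suc n)) * u ^ Suc n - of_real (euler_coeff q (Suc n)) * (u * of_real q) ^ Suc n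
        = u * (of_real (euler_coeff q n) * u ^ n)" for n
      unfolding euler_coeff_Suc[OF q, of n, symmetric]
      by (simp add: power_mult_distrib algebra_simps)
    ultimately have "(\<lambda>n. u * (of_real (euler_coeff q n) * u ^ n)) sums (E u - E (u * of_real q))"
      by simp
    moreover have "(\<lambda>n. u * (of_real (euler_coeff q n) * u ^ n)) sums (u * E u)"
      by (intro sums_mult E u)
    ultimately have "E u - E (u * of_real q) = u * E u" by (rule sums_unique2)
    then show ?thesis by (simp add: algebra_simps)
  qed
  have le: "norm (u * of_real (q ^ k)) < 1" for k
  proof -
    have "norm u * q ^ k \<le> norm u * 1" using q by (intro mult_left_mono power_le_one) auto
    then show ?thesis using u q by (simp add: norm_mult norm_power)
  qed
  have part: "E u * (\<Prod>k<N. 1 - u * of_real (q ^ k)) = E (u * of_real (q ^ N))" for N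
  proof (induction N)
    case (Suc N)
    then show ?case using step[OF le[of N]] by (simp add: mult_ac)
  qed simp
  have cont: "isCont E 0"
    unfolding E_def using E[of "1/2"]
    by (intro isCont_powser[where K = "1/2"]) (auto simp: sums_iff)
  have "(\<lambda>N. u * of_real (q ^ N)) \<longlonglongrightarrow> u * of_real 0"
    using q by (intro tendsto_intros LIMSEQ_power_zero) auto
  then have "(\<lambda>N. E (u * of_real (q ^ N))) \<longlonglongrightarrow> E 0"
    using isCont_tendsto_compose[OF cont] by simp
  moreover have "E 0 = 1" unfolding E_def by simp
  ultimately have lim: "(\<lambda>N. E u * (\<Prod>k<N. 1 - u * of_real (q ^ k))) \<longlonglongrightarrow> 1"
    by (simp only: part)
  have nz: "E u \<noteq> 0"
    using lim LIMSEQ_unique[OF tendsto_const] by fastforce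
  have "(\<lambda>N. E u * (\<Prod>k<N. 1 - u * of_real (q ^ k)) / E u) \<longlonglongrightarrow> 1 / E u"
    using nz by (intro tendsto_intros lim)
  then show "(\<lambda>N. \<Prod>k<N. 1 - u * of_real (q ^ k)) \<longlonglongrightarrow> 1 / (\<Sum>n. of_real (euler_coeff q n) * u ^ n)"
    using nz by (simp add: E_def)
  show "(\<Sum>n. of_real (euler_coeff q n) * u ^ n) \<noteq> 0" using nz by (simp add: E_def)
qed

text \<open>
  With \<open>x = cos \<theta>\<close> each factor of the product splits as
  \<open>(1 - t e^(i\<theta>) q^k) (1 - t e^(-i\<theta>) q^k)\<close>, so the product is the product of two Euler series, and
  \<open>q_hermite_trig\<close> identifies the coefficients of their Cauchy product.
\<close>

lemma q_hermite_generating_function: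
  fixes t :: complex
  assumes q: "0 < q" "q < 1" and t: "norm t < 1" and x: "\<bar>x\<bar> \<le> 1"
  shows "(\<lambda>n. of_real (q_hermite q n x) * t ^ n) sums
           (\<Prod>k. 1 / (1 - 2 * of_real x * t * of_real (q ^ k) + t\<^sup>2 * of_real (q ^ (2 * k))))"
proof -
  define z where "z = cis (arccos x)"
  have z: "z \<noteq> 0" "norm z = 1" "z + 1 / z = 2 * of_real x"
  proof -
    show "z \<noteq> 0" "norm z = 1" by (simp_all add: z_def)
    have "1 / z = cis (- arccos x)" by (simp add: z_def divide_inverse)
    then show "z + 1 / z = 2 * of_real x" using x by (simp add: z_def complex_eq_iff)
  qed
  define u v where "u = t * z" and "v = t * (1 / z)"
  have uv: "norm u < 1" "norm v < 1" using t z by (auto simp: u_def v_def norm_mult norm_divide)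
  have uv': "u + v = 2 * of_real x * t" "u * v = t\<^sup>2"
    using z(1) by (simp_all add: u_def v_def power2_eq_square flip: z(3)) (simp add: field_simps)
  define E where "E u = (\<Sum>n. complex_of_real (euler_coeff q n) * u ^ n)" for u
  have "(\<lambda>n. \<Sum>a\<le>n. (of_real (euler_coeff q a) * u ^ a) * (of_real (euler_coeff q (n - a)) * v ^ (n - a))) sums (E u * E v)"
    unfolding E_def by (intro Cauchy_product_sums summable_euler q uv)
  moreover have "(\<Sum>a\<le>n. (of_real (euler_coeff q a) * u ^ a) * (of_real (euler_coeff q (n - a)) * v ^ (n - a)))
      = of_real (q_hermite q n x) * t ^ n" for n
  proof -
    have "(of_real (euler_coeff q a) * u ^ a) * (of_real (euler_coeff q (n - a)) * v ^ (n - a))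
        = (of_real (euler_coeff q a) * z ^ a) * (of_real (euler_coeff q (n - a)) * (1 / z) ^ (n - a)) * t ^ n"
      if "a \<le> n" for a
    proof -
      have tn: "t ^ n = t ^ a * t ^ (n - a)" using that by (simp flip: power_add)
      show ?thesis unfolding tn u_def v_def power_mult_distrib by (simp only: mult_ac)
    qed
    then show ?thesis
      unfolding q_hermite_trig[OF q z(1,3)] sum_distrib_right by (intro sum.cong refl) simp
  qed
  ultimately have sums: "(\<lambda>n. of_real (q_hermite q n x) * t ^ n) sums (E u * E v)" by simp
  let ?f = "\<lambda>k. 1 / (1 - 2 * of_real x * t * of_real (q ^ k) + t\<^sup>2 * of_real (q ^ (2 * k)))"
  have f: "?f k = 1 / ((1 - u * of_real (q ^ k)) * (1 - v * of_real (q ^ k)))" for k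
  proof -
    have "1 - (u + v) * c + u * v * c\<^sup>2 = (1 - u * c) * (1 - v * c)" for c
      by (simp add: algebra_simps power2_eq_square)
    from this[of "of_real (q ^ k)"] show ?thesis
      unfolding uv' by (simp only: of_real_power power_mult mult.commute[of 2] of_real_mult)
  qed
  have lim: "(\<lambda>N. \<Prod>k<N. ?f k) \<longlonglongrightarrow> 1 / (1 / E u * (1 / E v))"
    unfolding f E_def prod_dividef prod.distrib prod.neutral_const
    using euler_product[OF q uv(1)] euler_product[OF q uv(2)]
    by (intro tendsto_intros) auto
  have Enz: "E u \<noteq> 0" "E v \<noteq> 0" using euler_product(2)[OF q] uv by (auto simp: E_def)
  have nz: "1 - w * of_real (q ^ k) \<noteq> 0" if "norm w < 1" for w :: complex and k
  proof
    assume "1 - w * of_real (q ^ k) = 0"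
    then have "norm (w * of_real (q ^ k)) = 1" by (metis norm_one right_minus_eq)
    moreover have "norm w * q ^ k \<le> norm w * 1" using q by (intro mult_left_mono power_le_one) auto
    ultimately show False using that q by (simp add: norm_mult norm_power)
  qed
  have "?f k \<noteq> 0" for k unfolding f using nz[OF uv(1)] nz[OF uv(2)] by simp
  then have "convergent_prod ?f"
    using lim Enz by (subst convergent_prod_iff_nz_lim) (auto simp: LIMSEQ_lessThan_iff_atMost)
  then have "?f has_prod (E u * E v)"
    using lim Enz by (intro convergent_prod_tendsto_imp_has_prod) (auto simp: LIMSEQ_lessThan_iff_atMost)
  from has_prod_unique[OF this] sums show ?thesis by (simp only:)
qed

section \<open>The product in the weight\<close>

definition theta_factor :: "real \<Rightarrow> real \<Rightarrow> nat \<Rightarrow> real" where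
  "theta_factor q x k = 1 + (2 - 4 * x\<^sup>2) * q ^ k + q ^ (2 * k)"

lemma theta_factor_nonneg:
  assumes "0 < q" "\<bar>x\<bar> \<le> 1" shows "0 \<le> theta_factor q x k"
proof -
  have "theta_factor q x k = (1 - q ^ k)\<^sup>2 + 4 * (1 - x\<^sup>2) * q ^ k"
    by (simp add: theta_factor_def power_even_eq) (simp add: power2_eq_square algebra_simps)
  moreover have "x\<^sup>2 \<le> 1" using assms by (simp add: abs_square_le_1)
  ultimately show ?thesis using assms by simp
qed

lemma theta_factor_pos:
  assumes "0 < q" "\<bar>x\<bar> < 1" shows "0 < theta_factor q x k"
proof -
  have "theta_factor q x k = (1 - q ^ k)\<^sup>2 + 4 * (1 - x\<^sup>2) * q ^ k"
    by (simp add: theta_factor_def power_even_eq) (simp add: power2_eq_square algebra_simps)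
  moreover have "x\<^sup>2 < 1" using assms by (simp add: abs_square_less_1)
  ultimately show ?thesis using assms by (simp add: add_nonneg_pos)
qed

lemma theta_factor_LIMSEQ:
  assumes q: "0 < q" "q < 1" and x: "\<bar>x\<bar> < 1"
  shows "(\<lambda>N. \<Prod>k<N. theta_factor q x k) \<longlonglongrightarrow> (\<Prod>k. theta_factor q x k)" "(\<Prod>k. theta_factor q x k) > 0"
proof -
  have "summable (\<lambda>k. \<bar>theta_factor q x k - 1\<bar>)"
  proof (rule summable_comparison_test)
    show "summable (\<lambda>k. \<bar>2 - 4 * x\<^sup>2\<bar> * q ^ k + (q\<^sup>2) ^ k)"
      using q by (intro summable_add summable_mult summable_geometric) (auto simp: abs_square_less_1)
    have "\<bar>theta_factor q x k - 1\<bar> \<le> \<bar>2 - 4 * x\<^sup>2\<bar> * q ^ k + (q\<^sup>2) ^ k" for k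
      using q abs_triangle_ineq[of "(2 - 4 * x\<^sup>2) * q ^ k" "q ^ (2 * k)"]
      by (simp add: theta_factor_def abs_mult power_mult)
    then show "\<exists>N. \<forall>k\<ge>N. norm \<bar>theta_factor q x k - 1\<bar> \<le> \<bar>2 - 4 * x\<^sup>2\<bar> * q ^ k + (q\<^sup>2) ^ k" by simp
  qed
  then show "(\<lambda>N. \<Prod>k<N. theta_factor q x k) \<longlonglongrightarrow> (\<Prod>k. theta_factor q x k)" "(\<Prod>k. theta_factor q x k) > 0"
    using theta_factor_pos[OF q(1) x] by (rule summable_imp_prodinf_LIMSEQ_pos)+
qed

text \<open>
  A bound uniform in \<open>N\<close> and \<open>x\<close>, from \<open>theta_factor q x k \<le> (1 + q^k)^2 \<le> exp (2 q^k)\<close>; it is the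
  dominating constant when the partial products are replaced by the infinite product under an integral.
\<close>

lemma theta_factor_prod_le:
  assumes q: "0 < q" "q < 1" and x: "\<bar>x\<bar> \<le> 1"
  shows "(\<Prod>k<N. theta_factor q x k) \<le> exp (2 / (1 - q))"
proof -
  have "(\<Prod>k<N. theta_factor q x k) \<le> (\<Prod>k<N. exp (2 * q ^ k))"
  proof (intro prod_mono conjI theta_factor_nonneg q x)
    fix k
    have "theta_factor q x k = (1 + q ^ k)\<^sup>2 - 4 * x\<^sup>2 * q ^ k"
      by (simp add: theta_factor_def power_even_eq) (simp add: power2_eq_square algebra_simps)
    also have "\<dots> \<le> (1 + q ^ k)\<^sup>2" using q by simp
    also have "\<dots> \<le> (exp (q ^ k))\<^sup>2" using q by (intro power_mono) auto
    finally show "theta_factor q x k \<le> exp (2 * q ^ k)" by (simp add: exp_double)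
  qed
  also have "\<dots> = exp (2 * (\<Sum>k<N. q ^ k))" by (simp add: exp_sum sum_distrib_left)
  also have "\<dots> \<le> exp (2 * (1 / (1 - q)))"
    using q sum_le_suminf[of "\<lambda>k. q ^ k" "{..<N}"] by (simp add: suminf_geometric)
  finally show ?thesis by simp
qed

section \<open>Fourier coefficients of the partial products\<close>

text \<open>
  On \<open>[-pi, 0]\<close> the cosine increases from \<open>-1\<close> to \<open>1\<close>, so this half period is the natural domain for
  \<open>x = cos \<theta>\<close>; the cosines of all nonzero integer frequencies, odd ones included, integrate to zero over it.
\<close>

lemma has_integral_cos_int:
  "((\<lambda>\<theta>. cos (of_int k * \<theta>)) has_integral (if k = 0 then pi else 0)) {-pi..0}"
proof (cases "k = 0")
  case True
  then show ?thesis using has_integral_const_real[of "1::real" "-pi" 0] by simp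
next
  case False
  have "((\<lambda>\<theta>. cos (of_int k * \<theta>)) has_integral
      (sin (of_int k * 0) / of_int k - sin (of_int k * (- pi)) / of_int k)) {-pi..0}"
    using False
    by (intro fundamental_theorem_of_calculus)
      (auto intro!: derivative_eq_intros simp: has_real_derivative_iff_has_vector_derivative[symmetric])
  moreover have "sin (of_int k * pi) = 0" by (simp add: mult.commute)
  ultimately show ?thesis using False by simp
qed

text \<open>
  The \<open>q\<close>-binomial theorem of order \<open>2 N\<close> at \<open>x = u q^(-N)\<close>.  The upper half of the factors is already
  \<open>\<Prod>k<N. 1 - u q^k\<close>; extracting \<open>-u q^(-k)\<close> from each factor \<open>1 - u q^(-k)\<close> of the lower half turns it
  into \<open>\<Prod>k<N. 1 - q^(k+1) / u\<close>.  Working with finite products avoids any theory of Laurent series.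
\<close>

lemma finite_jacobi_triple_product:
  fixes u :: complex
  assumes q: "0 < q" "q < 1" and u: "u \<noteq> 0"
  shows "(\<Prod>k<N. (1 - u * of_real (q ^ k)) * (1 - of_real (q ^ Suc k) / u))
     = (\<Sum>i\<le>2 * N. of_real (euler_coeff q i * euler_coeff q (2 * N - i) * theta_coeff q (int i - int N) / euler_coeff q (2 * N))
          * u powi (int i - int N))"
proof -
  define X where "X = u * of_real (q powi (- int N))"
  have split: "(\<Prod>k<2 * N. f k) = (\<Prod>k<N. f k) * (\<Prod>k<N. f (N + k))" for f :: "nat \<Rightarrow> complex"
  proof -
    have "(\<Prod>k<N + M. f k) = (\<Prod>k<N. f k) * (\<Prod>k<M. f (N + k))" for M
      by (induction M) (simp_all add: mult.assoc)
    then show ?thesis by (simp add: mult_2)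
  qed
  have shift: "X * of_real (q ^ (N + k)) = u * of_real (q ^ k)" for k
    using q by (simp add: X_def power_int_minus power_add field_simps)
  have e2: "euler_coeff q (2 * N) \<noteq> 0" using euler_coeff_pos[OF q, of "2 * N"] by simp
  have th: "theta_coeff q (- int N) \<noteq> 0" using q by (simp add: theta_coeff_def)
  have low: "of_real (theta_coeff q (- int N)) * u powi (- int N) * (\<Prod>k<N. 1 - X * of_real (q ^ k))
      = (\<Prod>k<N. 1 - of_real (q ^ Suc k) / u)"
  proof -
    have *: "of_real (theta_coeff q (- int M)) * u powi (- int M) * (\<Prod>k<M. 1 - u * of_real (q powi (- int (Suc k))))
        = (\<Prod>k<M. 1 - of_real (q ^ Suc k) / u)" for M
    proof (induction M)
      case (Suc M)
      have th1: "theta_coeff q (- int (Suc M)) = - (q ^ Suc M) * theta_coeff q (- int M)"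
      proof -
        have "theta_coeff q (- 1) = - q" by (simp add: theta_coeff_def)
        then show ?thesis using theta_coeff_add[OF q(1), of "-1" "- int M"] q by (simp add: mult_ac)
      qed
      have up1: "u powi (- int (Suc M)) = u powi (- int M) / u"
      proof -
        have "- int (Suc M) = - int M - 1" by simp
        then show ?thesis by (simp only: power_int_diff[OF disjI1[OF u]] power_int_1_right)
      qed
      have fac: "- of_real (q ^ Suc M) / u * (1 - u * of_real (q powi (- int (Suc M)))) = 1 - of_real (q ^ Suc M) / u"
      proof -
        have qq: "q powi (- int (Suc M)) = 1 / q ^ Suc M"
          by (simp only: power_int_minus power_int_of_nat inverse_eq_divide)
        show ?thesis unfolding qq using u q by (simp add: field_simps)
      qed
      have gen: "(- r * A) * (U / u) * (P * F) = A * U * P * (- r / u * F)" for r A U P F :: complex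
        by simp
      have
        "of_real (theta_coeff q (- int (Suc M))) * u powi (- int (Suc M)) * (\<Prod>k<Suc M. 1 - u * of_real (q powi (- int (Suc k))))
         = of_real (theta_coeff q (- int M)) * u powi (- int M) * (\<Prod>k<M. 1 - u * of_real (q powi (- int (Suc k))))
           * (- of_real (q ^ Suc M) / u * (1 - u * of_real (q powi (- int (Suc M)))))"
        by (simp only: prod.lessThan_Suc th1 up1 of_real_mult of_real_minus gen)
      also have "\<dots> = (\<Prod>k<Suc M. 1 - of_real (q ^ Suc k) / u)"
        unfolding Suc fac prod.lessThan_Suc ..
      finally show ?case .
    qed simp
    have "(\<Prod>k<N. 1 - X * of_real (q ^ k)) = (\<Prod>k<N. 1 - u * of_real (q powi (- int (Suc k))))"
    proof (rule prod.reindex_bij_witness[of _ "\<lambda>k. N - Suc k" "\<lambda>k. N - Suc k"])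
      fix k assume "k \<in> {..<N}"
      then have "q powi (- int N) * q ^ k = q powi (- int (Suc (N - Suc k)))"
        using q by (simp add: Suc_diff_Suc power_int_diff of_nat_diff) (simp add: power_int_minus divide_inverse mult.commute)
      then show "1 - u * of_real (q powi (- int (Suc (N - Suc k)))) = 1 - X * of_real (q ^ k)"
        by (simp only: X_def of_real_mult[symmetric] mult.assoc)
    qed auto
    then show ?thesis using *[of N] by simp
  qed
  have "(\<Prod>k<N. (1 - u * of_real (q ^ k)) * (1 - of_real (q ^ Suc k) / u))
      = of_real (theta_coeff q (- int N)) * u powi (- int N) * (\<Prod>k<2 * N. 1 - X * of_real (q ^ k))"
    unfolding split prod.distrib shift low[symmetric] by (simp only: mult_ac)
  also have "(\<Prod>k<2 * N. 1 - X * of_real (q ^ k)) =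
      (\<Sum>i\<le>2 * N. of_real (euler_coeff q i * euler_coeff q (2 * N - i) * theta_coeff q (int i)) * X ^ i) / of_real (euler_coeff q (2 * N))"
    unfolding q_binomial_theorem[OF q] using e2 by simp
  also have "of_real (theta_coeff q (- int N)) * u powi (- int N) * \<dots> = (\<Sum>i\<le>2 * N. of_real (euler_coeff q i * euler_coeff q (2 * N - i) * theta_coeff q (int i - int N) / euler_coeff q (2 * N))
          * u powi (int i - int N))"
    unfolding sum_divide_distrib sum_distrib_left
  proof (intro sum.cong refl)
    fix i
    have "theta_coeff q (int i - int N) = theta_coeff q (- int N) * theta_coeff q (int i) * (q powi (- int N)) ^ i"
    proof -
      have "q powi (- int N * int i) = (q powi (- int N)) ^ i"
        by (simp only: power_int_mult power_int_of_nat)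
      then show ?thesis using theta_coeff_add[OF q(1), of "- int N" "int i"] by simp
    qed
    moreover have "u powi (int i - int N) = u powi (- int N) * u ^ i"
      using u by (simp add: power_int_diff power_int_minus field_simps)
    ultimately show "of_real (theta_coeff q (- int N)) * u powi (- int N) *
        (of_real (euler_coeff q i * euler_coeff q (2 * N - i) * theta_coeff q (int i)) * X ^ i / of_real (euler_coeff q (2 * N))) =
      of_real (euler_coeff q i * euler_coeff q (2 * N - i) * theta_coeff q (int i - int N) / euler_coeff q (2 * N)) * u powi (int i - int N)"
      by (simp add: X_def power_mult_distrib)
  qed
  finally show ?thesis .
qed


definition jacobi_prod :: "real \<Rightarrow> nat \<Rightarrow> complex \<Rightarrow> complex" where
  "jacobi_prod q N u = (\<Prod>k<N. (1 - u * of_real (q ^ k)) * (1 - of_real (q ^ Suc k) / u))"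

text \<open>
  The integral over \<open>[-pi, 0]\<close> of the real part of \<open>e^(i s \<theta>)\<close> times the finite triple product at
  \<open>u = e^(2i\<theta>)\<close>, in expanded form: the condition selects the term of frequency zero.
\<close>

definition jacobi_moment :: "real \<Rightarrow> nat \<Rightarrow> int \<Rightarrow> real" where
  "jacobi_moment q N s = (\<Sum>i\<le>2 * N.
     euler_coeff q i * euler_coeff q (2 * N - i) * theta_coeff q (int i - int N) / euler_coeff q (2 * N)
       * (if s + 2 * (int i - int N) = 0 then pi else 0))"

lemma has_integral_jacobi_moment:
  assumes q: "0 < q" "q < 1"
  shows "((\<lambda>\<theta>. Re (cis \<theta> powi s * jacobi_prod q N ((cis \<theta>)\<^sup>2))) has_integral jacobi_moment q N s) {-pi..0}"
proof -
  let ?C = "\<lambda>i. euler_coeff q i * euler_coeff q (2 * N - i) * theta_coeff q (int i - int N) / euler_coeff q (2 * N)"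
  have "Re (cis \<theta> powi s * jacobi_prod q N ((cis \<theta>)\<^sup>2))
      = (\<Sum>i\<le>2 * N. ?C i * cos (of_int (s + 2 * (int i - int N)) * \<theta>))" for \<theta>
  proof -
    have 1: "cis \<theta> powi s * (of_real c * ((cis \<theta>)\<^sup>2) powi m) = of_real c * cis (of_int (s + 2 * m) * \<theta>)" for c m
    proof -
      have "((cis \<theta>)\<^sup>2) powi m = cis \<theta> powi (2 * m)" by (simp add: power_int_mult)
      then show ?thesis by (simp add: cis_power_int cis_mult ring_distribs mult_ac)
    qed
    have nz: "(cis \<theta>)\<^sup>2 \<noteq> 0" by simp
    show ?thesis
      unfolding jacobi_prod_def finite_jacobi_triple_product[OF q nz] sum_distrib_left 1
      by (simp only: Re_sum cis.sel scaleR_conv_of_real[symmetric] scaleR_complex.sel)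
  qed
  then show ?thesis unfolding jacobi_moment_def
    by (simp only:) (intro has_integral_sum has_integral_mult_right has_integral_cos_int finite_atMost)
qed

text \<open>
  Only the index \<open>i = N - s / 2\<close> survives, and the three reciprocal \<open>q\<close>-factorials at indices growing with
  \<open>N\<close> all tend to \<open>1 / (q;q)_\<infinity>\<close>.
\<close>

lemma jacobi_moment_LIMSEQ:
  assumes q: "0 < q" "q < 1"
  shows "(\<lambda>N. jacobi_moment q N s) \<longlonglongrightarrow>
     (if even s then pi * theta_coeff q (- (s div 2)) / q_pochhammer_inf q q else 0)"
proof (cases "even s")
  case False
  then have "s + 2 * (int i - int N) \<noteq> 0" for i N by presburger
  then show ?thesis using False by (simp add: jacobi_moment_def)
next
  case True
  then obtain m where m: "s = 2 * m" by blast
  let ?g = "\<lambda>N. euler_coeff q (nat (int N - m)) * euler_coeff q (nat (int N + m)) * theta_coeff q (- m) / euler_coeff q (2 * N) * pi"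
  have "\<forall>\<^sub>F N in sequentially. jacobi_moment q N s = ?g N"
    using eventually_ge_at_top[of "nat \<bar>m\<bar>"]
  proof eventually_elim
    case (elim N)
    define i0 where "i0 = nat (int N - m)"
    have i0: "int i0 = int N - m" "i0 \<le> 2 * N" "2 * N - i0 = nat (int N + m)" using elim by (auto simp: i0_def)
    have "jacobi_moment q N s = (\<Sum>i\<le>2 * N. if i = i0 then
        euler_coeff q i * euler_coeff q (2 * N - i) * theta_coeff q (int i - int N) / euler_coeff q (2 * N) * pi else 0)"
      unfolding jacobi_moment_def
    proof (intro sum.cong refl)
      fix i
      have "s + 2 * (int i - int N) = 0 \<longleftrightarrow> i = i0" using i0(1) m by presburger
      then show "euler_coeff q i * euler_coeff q (2 * N - i) * theta_coeff q (int i - int N) / euler_coeff q (2 * N)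
         * (if s + 2 * (int i - int N) = 0 then pi else 0) = (if i = i0 then
        euler_coeff q i * euler_coeff q (2 * N - i) * theta_coeff q (int i - int N) / euler_coeff q (2 * N) * pi else 0)" by simp
    qed
    also have "\<dots> = ?g N" using i0 by (simp add: i0_def[symmetric])
    finally show ?case .
  qed
  moreover have "?g \<longlonglongrightarrow> 1 / q_pochhammer_inf q q * (1 / q_pochhammer_inf q q) * theta_coeff q (- m) / (1 / q_pochhammer_inf q q) * pi"
  proof -
    have 1: "filterlim (\<lambda>N. nat (int N + c)) sequentially sequentially" for c
      unfolding filterlim_at_top
    proof
      fix Z
      show "\<forall>\<^sub>F x in sequentially. Z \<le> nat (int x + c)"
        using eventually_ge_at_top[of "Z + nat \<bar>c\<bar>"] by eventually_elim linarith
    qed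
    have 2: "filterlim (\<lambda>N. 2 * N :: nat) sequentially sequentially"
      by (intro filterlim_subseq strict_monoI) simp
    note lim = filterlim_compose[OF euler_coeff_LIMSEQ[OF q]]
    show ?thesis
      using lim[OF 1[of m]] lim[OF 1[of "- m"]] lim[OF 2] q_pochhammer_LIMSEQ(2)[OF q]
      by (intro tendsto_intros) auto
  qed
  ultimately have "(\<lambda>N. jacobi_moment q N s) \<longlonglongrightarrow> 1 / q_pochhammer_inf q q * (1 / q_pochhammer_inf q q) * theta_coeff q (- m) / (1 / q_pochhammer_inf q q) * pi"
    by (simp only: tendsto_cong)
  then show ?thesis using q_pochhammer_LIMSEQ(2)[OF q] m by (simp add: mult.commute)
qed

text \<open>
  With \<open>u = e^(2i\<theta>)\<close> one has \<open>2 - 4 (cos \<theta>)^2 = -(u + 1/u)\<close>, hence each factor is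
  \<open>(1 - u q^k) (1 - q^k / u)\<close>.  The triple product has \<open>q^(k+1) / u\<close> instead of \<open>q^k / u\<close>; the two extra
  factors account for this shift at the lower and at the upper end.
\<close>

lemma theta_prod_cos:
  fixes \<theta> :: real
  defines "u \<equiv> (cis \<theta>)\<^sup>2"
  shows "of_real (\<Prod>k<Suc N. theta_factor q (cos \<theta>) k) = (1 - 1 / u) * (1 - u * of_real (q ^ N)) * jacobi_prod q N u"
proof -
  have u: "u \<noteq> 0" by (simp add: u_def)
  have sum: "u + 1 / u = of_real (4 * (cos \<theta>)\<^sup>2 - 2)"
  proof -
    have "u = cis (2 * \<theta>)" "1 / u = cis (- (2 * \<theta>))" by (simp_all add: u_def Complex.DeMoivre divide_inverse)
    then show ?thesis by (simp add: complex_eq_iff cos_double_cos)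
  qed
  have "of_real (theta_factor q (cos \<theta>) k) = (1 - u * of_real (q ^ k)) * (1 - of_real (q ^ k) / u)" for k
  proof -
    have "of_real (theta_factor q (cos \<theta>) k) = 1 - of_real (4 * (cos \<theta>)\<^sup>2 - 2) * of_real (q ^ k) + of_real (q ^ k) * complex_of_real (q ^ k)"
      by (simp add: theta_factor_def power_even_eq) (simp add: algebra_simps power2_eq_square)
    also have "\<dots> = (1 - u * of_real (q ^ k)) * (1 - of_real (q ^ k) / u)"
      unfolding sum[symmetric] using u by (simp add: field_simps)
    finally show ?thesis .
  qed
  then have "of_real (\<Prod>k<Suc N. theta_factor q (cos \<theta>) k) = (\<Prod>k<Suc N. 1 - u * of_real (q ^ k)) * (\<Prod>k<Suc N. 1 - of_real (q ^ k) / u)"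
    by (simp only: of_real_prod prod.distrib)
  also have "(\<Prod>k<Suc N. 1 - of_real (q ^ k) / u) = (1 - 1 / u) * (\<Prod>k<N. 1 - of_real (q ^ Suc k) / u)"
    by (simp only: prod.lessThan_Suc_shift) simp
  also have "(\<Prod>k<Suc N. 1 - u * of_real (q ^ k)) = (\<Prod>k<N. 1 - u * of_real (q ^ k)) * (1 - u * of_real (q ^ N))"
    by (rule prod.lessThan_Suc)
  finally show ?thesis by (simp only: jacobi_prod_def prod.distrib mult_ac)
qed


lemma has_integral_q_hermite_theta_prod:
  assumes q: "0 < q" "q < 1"
  shows "((\<lambda>\<theta>. q_hermite q n (cos \<theta>) * (\<Prod>k<Suc N. theta_factor q (cos \<theta>) k)) has_integral
     (\<Sum>a\<le>n. euler_coeff q a * euler_coeff q (n - a) *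
        ((1 + q ^ N) * jacobi_moment q N (2 * int a - int n) - jacobi_moment q N (2 * int a - int n - 2)
          - q ^ N * jacobi_moment q N (2 * int a - int n + 2)))) {-pi..0}"
proof -
  let ?J = "\<lambda>s \<theta>. Re (cis \<theta> powi s * jacobi_prod q N ((cis \<theta>)\<^sup>2))"
  have "q_hermite q n (cos \<theta>) * (\<Prod>k<Suc N. theta_factor q (cos \<theta>) k) =
     (\<Sum>a\<le>n. euler_coeff q a * euler_coeff q (n - a) *
        ((1 + q ^ N) * ?J (2 * int a - int n) \<theta> - ?J (2 * int a - int n - 2) \<theta>
          - q ^ N * ?J (2 * int a - int n + 2) \<theta>))" for \<theta>
  proof -
    define z where "z = cis \<theta>"
    define P where "P = jacobi_prod q N (z\<^sup>2)"
    have z: "z \<noteq> 0" "z + 1 / z = 2 * of_real (cos \<theta>)"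
      by (simp_all add: z_def divide_inverse) (simp add: complex_eq_iff)
    have "complex_of_real (q_hermite q n (cos \<theta>) * (\<Prod>k<Suc N. theta_factor q (cos \<theta>) k)) =
       (\<Sum>a\<le>n. (of_real (euler_coeff q a) * z ^ a) * (of_real (euler_coeff q (n - a)) * (1 / z) ^ (n - a)))
         * ((1 - 1 / z\<^sup>2) * (1 - z\<^sup>2 * of_real (q ^ N)) * P)"
      unfolding of_real_mult q_hermite_trig[OF q z] theta_prod_cos by (simp only: z_def P_def)
    also have "\<dots> = (\<Sum>a\<le>n. of_real (euler_coeff q a * euler_coeff q (n - a)) *
        (of_real (1 + q ^ N) * (z powi (2 * int a - int n) * P) - z powi (2 * int a - int n - 2) * P
          - of_real (q ^ N) * (z powi (2 * int a - int n + 2) * P)))"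
      unfolding sum_distrib_right
    proof (intro sum.cong refl)
      fix a assume a: "a \<in> {..n}"
      define w where "w = z powi (2 * int a - int n)"
      have w: "w = z ^ a * (1 / z) ^ (n - a)"
      proof -
        have "2 * int a - int n = int a - int (n - a)" using a by auto
        then show ?thesis by (simp only: w_def power_int_diff[OF disjI1[OF z(1)]] power_int_of_nat) (simp add: power_one_over)
      qed
      have w2: "z powi (2 * int a - int n - 2) = w / z\<^sup>2" "z powi (2 * int a - int n + 2) = w * z\<^sup>2"
        unfolding w_def using z(1) by (simp_all add: power_int_diff power_int_add)
      have "(of_real (euler_coeff q a) * z ^ a) * (of_real (euler_coeff q (n - a)) * (1 / z) ^ (n - a))
         = of_real (euler_coeff q a * euler_coeff q (n - a)) * w"
        unfolding w by (simp only: of_real_mult mult_ac)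
      moreover have "w * ((1 - 1 / z\<^sup>2) * (1 - z\<^sup>2 * of_real (q ^ N)) * P)
          = of_real (1 + q ^ N) * (w * P) - w / z\<^sup>2 * P - of_real (q ^ N) * (w * z\<^sup>2 * P)"
        using z(1) by (simp add: field_simps)
      ultimately show "of_real (euler_coeff q a) * z ^ a * (of_real (euler_coeff q (n - a)) * (1 / z) ^ (n - a))
          * ((1 - 1 / z\<^sup>2) * (1 - z\<^sup>2 * of_real (q ^ N)) * P) =
        of_real (euler_coeff q a * euler_coeff q (n - a)) *
          (of_real (1 + q ^ N) * (z powi (2 * int a - int n) * P) - z powi (2 * int a - int n - 2) * P
          - of_real (q ^ N) * (z powi (2 * int a - int n + 2) * P))"
        unfolding w2 w_def[symmetric] by (simp only: mult.assoc)
    qed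
    finally have "Re (complex_of_real (q_hermite q n (cos \<theta>) * (\<Prod>k<Suc N. theta_factor q (cos \<theta>) k))) = Re \<dots>"
      by (simp only:)
    then show ?thesis
      by (simp only: Re_complex_of_real Re_sum minus_complex.sel scaleR_conv_of_real[symmetric] scaleR_complex.sel z_def P_def)
  qed
  then show ?thesis
    by (simp only:) (intro has_integral_sum has_integral_mult_right has_integral_diff has_integral_jacobi_moment[OF q] finite_atMost)
qed

text \<open>
  Odd \<open>n\<close> give only odd frequencies.  For \<open>n = 2 m\<close> the limit is a difference of two sums of the kind
  treated in \<open>theta_sum_vanishes\<close>, with shifts \<open>m\<close> and \<open>m - 1\<close>; both vanish unless \<open>m = 0\<close>.
\<close>

lemma q_hermite_theta_integral_LIMSEQ:
  assumes q: "0 < q" "q < 1"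
  shows "(\<lambda>N. integral {-pi..0} (\<lambda>\<theta>. q_hermite q n (cos \<theta>) * (\<Prod>k<Suc N. theta_factor q (cos \<theta>) k)))
     \<longlonglongrightarrow> (if n = 0 then 2 * pi / q_pochhammer_inf q q else 0)"
proof -
  define K where "K s = (if even s then pi * theta_coeff q (- (s div 2)) / q_pochhammer_inf q q else 0)" for s
  have "(\<lambda>N. \<Sum>a\<le>n. euler_coeff q a * euler_coeff q (n - a) *
        ((1 + q ^ N) * jacobi_moment q N (2 * int a - int n) - jacobi_moment q N (2 * int a - int n - 2)
          - q ^ N * jacobi_moment q N (2 * int a - int n + 2)))
     \<longlonglongrightarrow> (\<Sum>a\<le>n. euler_coeff q a * euler_coeff q (n - a) * ((1 + 0) * K (2 * int a - int n) - K (2 * int a - int n - 2)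
          - 0 * K (2 * int a - int n + 2)))"
    unfolding K_def using q by (intro tendsto_intros jacobi_moment_LIMSEQ LIMSEQ_power_zero) auto
  also have "(\<Sum>a\<le>n. euler_coeff q a * euler_coeff q (n - a) * ((1 + 0) * K (2 * int a - int n) - K (2 * int a - int n - 2)
          - 0 * K (2 * int a - int n + 2))) = (if n = 0 then 2 * pi / q_pochhammer_inf q q else 0)"
  proof (cases "even n")
    case False
    then show ?thesis by (auto simp: K_def intro!: sum.neutral)
  next
    case True
    then obtain m where n: "n = 2 * m" by blast
    have K: "K (2 * i) = pi / q_pochhammer_inf q q * theta_coeff q (- i)" for i by (simp add: K_def)
    have "(\<Sum>a\<le>n. euler_coeff q a * euler_coeff q (n - a) * ((1 + 0) * K (2 * int a - int n) - K (2 * int a - int n - 2)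
          - 0 * K (2 * int a - int n + 2)))
        = (\<Sum>a\<le>n. pi / q_pochhammer_inf q q * (euler_coeff q a * euler_coeff q (n - a) * theta_coeff q (int m - int a)
             - euler_coeff q a * euler_coeff q (n - a) * theta_coeff q (int m + 1 - int a)))"
    proof (intro sum.cong refl)
      fix a
      have "2 * int a - int n = 2 * (int a - int m)" "2 * int a - int n - 2 = 2 * (int a - int m - 1)"
        using n by auto
      then show "euler_coeff q a * euler_coeff q (n - a) * ((1 + 0) * K (2 * int a - int n) - K (2 * int a - int n - 2)
          - 0 * K (2 * int a - int n + 2)) = pi / q_pochhammer_inf q q * (euler_coeff q a * euler_coeff q (n - a) * theta_coeff q (int m - int a)
             - euler_coeff q a * euler_coeff q (n - a) * theta_coeff q (int m + 1 - int a))"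
        by (simp only: K) (simp add: algebra_simps)
    qed
    also have "\<dots> = pi / q_pochhammer_inf q q * ((\<Sum>a\<le>n. euler_coeff q a * euler_coeff q (n - a) * theta_coeff q (int m - int a))
         - (\<Sum>a\<le>n. euler_coeff q a * euler_coeff q (n - a) * theta_coeff q (int m + 1 - int a)))"
      unfolding sum_subtractf[symmetric] sum_distrib_left ..
    \<comment> \<open>the reflection \<open>a \<mapsto> n - a\<close> brings both sums into the form of \<open>theta_sum_vanishes\<close>\<close>
    also have "(\<Sum>a\<le>n. euler_coeff q a * euler_coeff q (n - a) * theta_coeff q (int m - int a))
        = (\<Sum>a\<le>n. euler_coeff q a * euler_coeff q (n - a) * theta_coeff q (int a - int m))"
      using n by (intro sum.reindex_bij_witness[of _ "\<lambda>a. n - a" "\<lambda>a. n - a"]) (auto simp: of_nat_diff mult.commute)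
    also have "(\<Sum>a\<le>n. euler_coeff q a * euler_coeff q (n - a) * theta_coeff q (int m + 1 - int a))
        = (\<Sum>a\<le>n. euler_coeff q a * euler_coeff q (n - a) * theta_coeff q (int a - (int m - 1)))"
      using n by (intro sum.reindex_bij_witness[of _ "\<lambda>a. n - a" "\<lambda>a. n - a"]) (auto simp: of_nat_diff mult.commute algebra_simps)
    finally show ?thesis
      using theta_sum_vanishes[OF q, of "int m" n] theta_sum_vanishes[OF q, of "int m - 1" n] n
      by (cases "m = 0") auto
  qed
  finally show ?thesis
    by (simp only: integral_unique[OF has_integral_q_hermite_theta_prod[OF q]])
qed

section \<open>Orthogonality with respect to the weight\<close>

lemma continuous_on_q_hermite [continuous_intros]:
  "continuous_on S f \<Longrightarrow> continuous_on S (\<lambda>x. q_hermite q n (f x))"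
proof -
  have "continuous_on UNIV (q_hermite q n)"
  proof (induction q n "0::real" rule: q_hermite.induct)
    case (3 q n)
    then show ?case by (simp add: divide_inverse) (intro continuous_intros; assumption)
  qed (simp_all add: divide_inverse continuous_intros)
  then show "continuous_on S f \<Longrightarrow> continuous_on S (\<lambda>x. q_hermite q n (f x))"
    by (rule continuous_on_compose2) auto
qed

lemma continuous_on_theta_factor [continuous_intros]:
  "continuous_on S f \<Longrightarrow> continuous_on S (\<lambda>x. theta_factor q (f x) k)"
  unfolding theta_factor_def by (intro continuous_intros)

lemma abs_cos_less_1:
  fixes \<theta> :: real
  assumes "\<theta> \<in> {-pi<..<0}" shows "\<bar>cos \<theta>\<bar> < 1"
proof -
  have "sin (- \<theta>) > 0" using assms by (intro sin_gt_zero) auto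
  then have "0 < (sin \<theta>)\<^sup>2" by simp
  then have "(cos \<theta>)\<^sup>2 < 1" unfolding sin_squared_eq by simp
  then show ?thesis by (simp add: abs_square_less_1)
qed

text \<open>
  Dominated convergence.  The open interval matters: at \<open>\<theta> = -pi\<close> and \<open>\<theta> = 0\<close> the factor with \<open>k = 0\<close>
  vanishes, so that \<open>theta_factor_LIMSEQ\<close> does not apply.
\<close>

lemma q_hermite_theta_integral:
  fixes n :: nat
  assumes q: "0 < q" "q < 1"
  defines "F \<equiv> \<lambda>\<theta>. q_hermite q n (cos \<theta>) * (\<Prod>k. theta_factor q (cos \<theta>) k)"
  shows "F absolutely_integrable_on {-pi<..<0}"
    and "integral {-pi<..<0} F = (if n = 0 then 2 * pi / q_pochhammer_inf q q else 0)"
proof -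
  let ?f = "\<lambda>N \<theta>. q_hermite q n (cos \<theta>) * (\<Prod>k<Suc N. theta_factor q (cos \<theta>) k)"
  have "compact ((\<lambda>x. q_hermite q n x) ` {-1..1})"
    by (intro compact_continuous_image continuous_intros) auto
  then have "bounded ((\<lambda>x. q_hermite q n x) ` {-1..1})" by (rule compact_imp_bounded)
  then obtain B where B: "\<And>x. \<bar>x\<bar> \<le> 1 \<Longrightarrow> \<bar>q_hermite q n x\<bar> \<le> B"
    by (force simp: bounded_iff)
  note cos1 = abs_cos_less_1
  have bound: "norm (?f N \<theta>) \<le> B * exp (2 / (1 - q))" for N \<theta>
    using mult_mono[OF B[of "cos \<theta>"] theta_factor_prod_le[OF q, of "cos \<theta>" "Suc N"]]
      prod_nonneg[of "{..<Suc N}" "theta_factor q (cos \<theta>)"] theta_factor_nonneg[OF q(1), of "cos \<theta>"] B[of "cos \<theta>"]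
    by (simp only: real_norm_def abs_mult) (force intro: order_trans[OF abs_ge_zero])
  have int: "?f N integrable_on {-pi<..<0}" for N
    unfolding integrable_on_open_interval_real
    by (intro integrable_continuous_real continuous_intros)
  have lim: "(\<lambda>N. ?f N \<theta>) \<longlonglongrightarrow> F \<theta>" if "\<theta> \<in> {-pi<..<0}" for \<theta>
    unfolding F_def using theta_factor_LIMSEQ(1)[OF q cos1[OF that]]
    by (intro tendsto_intros) (rule LIMSEQ_Suc)
  have const: "(\<lambda>\<theta>::real. B * exp (2 / (1 - q))) integrable_on {-pi<..<0}"
    unfolding integrable_on_open_interval_real by (intro integrable_continuous_real continuous_intros)
  note dc = dominated_convergence[OF int const bound lim]
  have bF: "norm (F \<theta>) \<le> B * exp (2 / (1 - q))" if "\<theta> \<in> {-pi<..<0}" for \<theta>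
    using bound by (intro LIMSEQ_le_const2[OF tendsto_norm[OF lim[OF that]]]) blast
  show "F absolutely_integrable_on {-pi<..<0}"
    by (rule absolutely_integrable_integrable_bound[OF bF dc(1) const])
  show "integral {-pi<..<0} F = (if n = 0 then 2 * pi / q_pochhammer_inf q q else 0)"
    using LIMSEQ_unique[OF dc(2)] q_hermite_theta_integral_LIMSEQ[OF q, of n]
    by (simp add: integral_open_interval_real)
qed

definition unit_coord :: "real \<Rightarrow> real \<Rightarrow> real" where
  "unit_coord q \<xi> = sqrt (1 - q) / sqrt 2 * \<xi>"

text \<open>
  The function under the square root in the kernel.
\<close>

definition bargmann_weight :: "real \<Rightarrow> real \<Rightarrow> real" where
  "bargmann_weight q \<xi> = sqrt 2 * q_weight q (sqrt 2 * \<xi>)"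

lemma unit_coord_less_1:
  assumes "q < 1" "\<xi> \<in> q_interval q" shows "\<bar>unit_coord q \<xi>\<bar> < 1"
proof -
  have s: "sqrt (1 - q) > 0" using assms by simp
  have "\<bar>\<xi>\<bar> < sqrt 2 / sqrt (1 - q)" using assms by (auto simp: q_interval_def)
  then have "sqrt (1 - q) * \<bar>\<xi>\<bar> < sqrt 2" using s by (simp add: field_simps)
  then show ?thesis using s by (simp add: unit_coord_def abs_mult)
qed

lemma bargmann_weight_eq:
  assumes "q < 1"
  shows "bargmann_weight q \<xi> = sqrt 2 * q_pochhammer_inf q q * sqrt (1 - q) / (4 * pi * sqrt (1 - (unit_coord q \<xi>)\<^sup>2))
           * (\<Prod>k. theta_factor q (unit_coord q \<xi>) k)"
proof -
  have "(unit_coord q \<xi>)\<^sup>2 = (1 - q) * \<xi>\<^sup>2 / 2"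
    using assms by (simp add: unit_coord_def power_mult_distrib power_divide)
  then have "(1 - q) * (sqrt 2 * \<xi>)\<^sup>2 / 4 = (unit_coord q \<xi>)\<^sup>2" "(sqrt 2 * \<xi>)\<^sup>2 * (1 - q) = 4 * (unit_coord q \<xi>)\<^sup>2"
    by (simp_all add: power_mult_distrib)
  then show ?thesis by (simp add: bargmann_weight_def q_weight_def theta_factor_def)
qed

lemma bargmann_weight_pos:
  assumes q: "0 < q" "q < 1" and \<xi>: "\<xi> \<in> q_interval q"
  shows "bargmann_weight q \<xi> > 0"
proof -
  have "\<bar>unit_coord q \<xi>\<bar> < 1" using unit_coord_less_1 q \<xi> by blast
  moreover from this have "(unit_coord q \<xi>)\<^sup>2 < 1" by (simp add: abs_square_less_1)
  ultimately show ?thesis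
    unfolding bargmann_weight_eq[OF q(2)] using q q_pochhammer_LIMSEQ(2)[OF q] theta_factor_LIMSEQ(2)[OF q]
    by (intro mult_pos_pos divide_pos_pos) auto
qed

lemma sets_q_interval [measurable, simp]: "q_interval q \<in> sets lebesgue"
  by (simp add: q_interval_def)

text \<open>
  The substitution \<open>\<xi> = sqrt 2 / sqrt (1 - q) * cos \<theta>\<close>: its Jacobian cancels the factor
  \<open>1 / sqrt (1 - x^2)\<close> of the weight and leaves the constant \<open>(q;q)_\<infinity> / (2 pi)\<close>.
\<close>

lemma bargmann_weight_q_hermite_integral:
  assumes q: "0 < q" "q < 1"
  shows "integrable (lebesgue_on (q_interval q)) (\<lambda>\<xi>. bargmann_weight q \<xi> * q_hermite q n (unit_coord q \<xi>))"
    and "(\<integral>\<xi>. bargmann_weight q \<xi> * q_hermite q n (unit_coord q \<xi>) \<partial>lebesgue_on (q_interval q)) = (if n = 0 then 1 else 0)"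
proof -
  define c where "c = sqrt 2 / sqrt (1 - q)"
  have c: "c > 0" using q by (simp add: c_def)
  define f where "f \<xi> = bargmann_weight q \<xi> * q_hermite q n (unit_coord q \<xi>)" for \<xi>
  define F where "F \<theta> = q_hermite q n (cos \<theta>) * (\<Prod>k. theta_factor q (cos \<theta>) k)" for \<theta>
  define S where "S = {-pi<..<0::real}"
  define Q where "Q = q_pochhammer_inf q q"
  have Q: "Q > 0" using q_pochhammer_LIMSEQ(2)[OF q] by (simp add: Q_def)
  have x: "unit_coord q (c * cos \<theta>) = cos \<theta>" for \<theta> using q by (simp add: unit_coord_def c_def)
  have eq: "\<bar>- c * sin \<theta>\<bar> * f (c * cos \<theta>) = Q / (2 * pi) * F \<theta>" if "\<theta> \<in> S" for \<theta>
  proof -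
    have "sin (- \<theta>) > 0" using that by (intro sin_gt_zero) (auto simp: S_def)
    then have s: "sin \<theta> < 0" by simp
    have sq: "sqrt (1 - (cos \<theta>)\<^sup>2) = - sin \<theta>"
      using s by (simp add: sin_squared_eq[symmetric])
    have cc: "c * sqrt (1 - q) = sqrt 2" using q by (simp add: c_def)
    have "\<bar>- c * sin \<theta>\<bar> * f (c * cos \<theta>) = (c * sqrt (1 - q)) * sqrt 2 * Q / (4 * pi) * F \<theta>"
      unfolding f_def F_def bargmann_weight_eq[OF q(2)] x sq Q_def using s c
      by (simp add: abs_mult field_simps)
    then show ?thesis unfolding cc by simp
  qed
  have img: "(\<lambda>\<theta>. c * cos \<theta>) ` S = q_interval q"
  proof (intro equalityI subsetI)
    fix \<xi> assume "\<xi> \<in> (\<lambda>\<theta>. c * cos \<theta>) ` S"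
    then obtain \<theta> where th: "\<theta> \<in> S" "\<xi> = c * cos \<theta>" by blast
    have "-1 < cos \<theta>" "cos \<theta> < 1" using abs_cos_less_1[of \<theta>] th(1) by (auto simp: S_def)
    then have "- c < c * cos \<theta>" "c * cos \<theta> < c" using c mult_strict_left_mono[of "-1" "cos \<theta>" c] by auto
    then show "\<xi> \<in> q_interval q" using th by (auto simp: q_interval_def c_def)
  next
    fix \<xi> assume xi: "\<xi> \<in> q_interval q"
    have "-1 < \<xi> / c \<and> \<xi> / c < 1"
      using xi c by (auto simp: q_interval_def c_def[symmetric] field_simps)
    then have "arccos (\<xi> / c) \<in> {0<..<pi}" "cos (- arccos (\<xi> / c)) = \<xi> / c"
      using arccos_lt_bounded[of "\<xi> / c"] by auto
    then show "\<xi> \<in> (\<lambda>\<theta>. c * cos \<theta>) ` S"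
      using c by (intro image_eqI[of _ _ "- arccos (\<xi> / c)"]) (auto simp: S_def)
  qed
  have inj: "inj_on (\<lambda>\<theta>. c * cos \<theta>) S"
  proof (rule inj_onI)
    fix a b assume "a \<in> S" "b \<in> S" "c * cos a = c * cos b"
    then show "a = b" using c cos_inj_pi[of "- a" "- b"] by (auto simp: S_def)
  qed
  have ai: "(\<lambda>\<theta>. Q / (2 * pi) * F \<theta>) absolutely_integrable_on S"
    unfolding F_def S_def by (intro set_integrable_mult_right q_hermite_theta_integral(1) q)
  have "(\<lambda>\<theta>. \<bar>- c * sin \<theta>\<bar> * f (c * cos \<theta>)) absolutely_integrable_on S"
    using ai by (subst set_integrable_cong[OF refl refl eq]) auto
  moreover have "integral S (\<lambda>\<theta>. \<bar>- c * sin \<theta>\<bar> * f (c * cos \<theta>)) = (if n = 0 then 1 else 0)"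
  proof -
    have "integral S (\<lambda>\<theta>. \<bar>- c * sin \<theta>\<bar> * f (c * cos \<theta>)) = integral S (\<lambda>\<theta>. Q / (2 * pi) * F \<theta>)"
      by (rule integral_cong[OF eq])
    also have "\<dots> = Q / (2 * pi) * integral S F" by simp
    also have "\<dots> = (if n = 0 then 1 else 0)"
      unfolding F_def S_def q_hermite_theta_integral(2)[OF q] using Q by (simp add: Q_def)
    finally show ?thesis .
  qed
  ultimately have *: "f absolutely_integrable_on ((\<lambda>\<theta>. c * cos \<theta>) ` S) \<and>
      integral ((\<lambda>\<theta>. c * cos \<theta>) ` S) f = (if n = 0 then 1 else 0)"
    by (subst has_absolute_integral_change_of_variables_1'[OF _ _ inj, symmetric, where g' = "\<lambda>\<theta>. - c * sin \<theta>"])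
      (auto simp: S_def intro!: derivative_eq_intros)
  then have int: "integrable (lebesgue_on (q_interval q)) f"
    unfolding img by (intro absolutely_integrable_imp_integrable) auto
  then show "integrable (lebesgue_on (q_interval q)) (\<lambda>\<xi>. bargmann_weight q \<xi> * q_hermite q n (unit_coord q \<xi>))"
    by (simp add: f_def[abs_def])
  show "(\<integral>\<xi>. bargmann_weight q \<xi> * q_hermite q n (unit_coord q \<xi>) \<partial>lebesgue_on (q_interval q)) = (if n = 0 then 1 else 0)"
    using lebesgue_integral_eq_integral[OF int] * unfolding img by (simp add: f_def[abs_def])
qed


lemma integrable_bargmann_weight_continuous:
  assumes q: "0 < q" "q < 1" and p: "continuous_on UNIV p"
  shows "integrable (lebesgue_on (q_interval q)) (\<lambda>\<xi>. bargmann_weight q \<xi> * (p \<xi> :: real))"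
proof -
  let ?M = "lebesgue_on (q_interval q)" and ?c = "sqrt 2 / sqrt (1 - q)"
  have v: "integrable ?M (bargmann_weight q)" using bargmann_weight_q_hermite_integral(1)[OF q, of 0] by simp
  have "compact (p ` {- ?c .. ?c})"
    by (intro compact_continuous_image continuous_on_subset[OF p]) auto
  then have "bounded (p ` {- ?c .. ?c})" by (rule compact_imp_bounded)
  then obtain B where "\<forall>y\<in>p ` {- ?c .. ?c}. norm y \<le> B" unfolding bounded_iff by blast
  then have B: "\<bar>p \<xi>\<bar> \<le> B" if "\<xi> \<in> q_interval q" for \<xi>
    using that by (auto simp: q_interval_def)
  have [measurable]: "p \<in> borel_measurable ?M"
    by (intro continuous_imp_measurable_on_sets_lebesgue continuous_on_subset[OF p]) auto
  note [measurable] = borel_measurable_integrable[OF v]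
  show ?thesis
  proof (rule Bochner_Integration.integrable_bound[of _ "\<lambda>\<xi>. bargmann_weight q \<xi> * B"])
    show "integrable ?M (\<lambda>\<xi>. bargmann_weight q \<xi> * B)" using v by simp
    show "AE \<xi> in ?M. norm (bargmann_weight q \<xi> * p \<xi>) \<le> norm (bargmann_weight q \<xi> * B)"
    proof (rule AE_I2)
      fix \<xi> assume "\<xi> \<in> space ?M"
      then have xi: "\<xi> \<in> q_interval q" by simp
      have "\<bar>p \<xi>\<bar> \<le> \<bar>B\<bar>" using B[OF xi] by linarith
      then show "norm (bargmann_weight q \<xi> * p \<xi>) \<le> norm (bargmann_weight q \<xi> * B)"
        by (simp add: abs_mult mult_left_mono)
    qed
  qed simp
qed

lemma continuous_on_unit_coord [continuous_intros]: "continuous_on S (unit_coord q)"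
  unfolding unit_coord_def by (intro continuous_intros)

text \<open>
  The recurrence of the polynomials lets one trade the first index for the second:
  \<open>(1 - q^(m+1)) L (h (m+1) * h n)\<close> equals
  \<open>(1 - q^(n+1)) L (h m * h (n+1)) + L (h m * h (n-1)) - L (h (m-1) * h n)\<close>, so the case
  \<open>m = 0\<close>, which is \<open>bargmann_weight_q_hermite_integral\<close>, determines all others.
\<close>

lemma q_hermite_orthogonal:
  assumes q: "0 < q" "q < 1"
  shows "(\<integral>\<xi>. bargmann_weight q \<xi> * (q_hermite q m (unit_coord q \<xi>) * q_hermite q n (unit_coord q \<xi>)) \<partial>lebesgue_on (q_interval q))
           = (if m = n then euler_coeff q m else 0)"
proof -
  let ?M = "lebesgue_on (q_interval q)"
  define h where "h n \<xi> = q_hermite q n (unit_coord q \<xi>)" for n \<xi>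
  \<comment> \<open>\<open>h' n\<close> is \<open>h (n - 1)\<close>, with \<open>0\<close> for \<open>n = 0\<close>, so that the recurrence holds from \<open>n = 0\<close> on\<close>
  define h' where "h' n = (case n of 0 \<Rightarrow> (\<lambda>_. 0) | Suc k \<Rightarrow> h k)" for n
  have cont: "continuous_on UNIV (h n)" "continuous_on UNIV (h' n)" for n
    unfolding h'_def h_def by (auto split: nat.split intro!: continuous_intros)
  have rec: "(1 - q ^ Suc n) * h (Suc n) \<xi> = 2 * unit_coord q \<xi> * h n \<xi> - h' n \<xi>" for n \<xi>
  proof (cases n)
    case 0
    then show ?thesis using q by (simp add: h_def h'_def)
  next
    case (Suc k)
    then show ?thesis using q_hermite_recurrence[OF q, of k "unit_coord q \<xi>"] by (simp only: h_def h'_def nat.case)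
  qed
  define L where "L p = (\<integral>\<xi>. bargmann_weight q \<xi> * p \<xi> \<partial>?M)" for p :: "real \<Rightarrow> real"
  have int: "integrable ?M (\<lambda>\<xi>. bargmann_weight q \<xi> * p \<xi>)" if "continuous_on UNIV p" for p
    by (rule integrable_bargmann_weight_continuous[OF q that])
  have step: "(1 - q ^ Suc m) * L (\<lambda>\<xi>. h (Suc m) \<xi> * h n \<xi>)
      = (1 - q ^ Suc n) * L (\<lambda>\<xi>. h m \<xi> * h (Suc n) \<xi>) + L (\<lambda>\<xi>. h m \<xi> * h' n \<xi>) - L (\<lambda>\<xi>. h' m \<xi> * h n \<xi>)" for m n
  proof -
    have i: "integrable ?M (\<lambda>\<xi>. bargmann_weight q \<xi> * (h m \<xi> * h (Suc n) \<xi>))" "integrable ?M (\<lambda>\<xi>. bargmann_weight q \<xi> * (h m \<xi> * h' n \<xi>))"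
      "integrable ?M (\<lambda>\<xi>. bargmann_weight q \<xi> * (h' m \<xi> * h n \<xi>))" "integrable ?M (\<lambda>\<xi>. bargmann_weight q \<xi> * (h (Suc m) \<xi> * h n \<xi>))"
      by (intro int continuous_intros cont)+
    have "(1 - q ^ Suc m) * L (\<lambda>\<xi>. h (Suc m) \<xi> * h n \<xi>)
        = (\<integral>\<xi>. (1 - q ^ Suc m) * (bargmann_weight q \<xi> * (h (Suc m) \<xi> * h n \<xi>)) \<partial>?M)"
      unfolding L_def by simp
    also have "\<dots> = (\<integral>\<xi>. (1 - q ^ Suc n) * (bargmann_weight q \<xi> * (h m \<xi> * h (Suc n) \<xi>))
       + bargmann_weight q \<xi> * (h m \<xi> * h' n \<xi>) - bargmann_weight q \<xi> * (h' m \<xi> * h n \<xi>) \<partial>?M)"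
    proof (rule Bochner_Integration.integral_cong[OF refl])
      fix \<xi>
      have "(1 - q ^ Suc m) * (bargmann_weight q \<xi> * (h (Suc m) \<xi> * h n \<xi>))
          = bargmann_weight q \<xi> * h n \<xi> * ((1 - q ^ Suc m) * h (Suc m) \<xi>)" by (simp only: mult_ac)
      also have "\<dots> = bargmann_weight q \<xi> * h m \<xi> * ((1 - q ^ Suc n) * h (Suc n) \<xi>)
          + bargmann_weight q \<xi> * (h m \<xi> * h' n \<xi>) - bargmann_weight q \<xi> * (h' m \<xi> * h n \<xi>)"
        unfolding rec by (simp add: algebra_simps)
      finally show "(1 - q ^ Suc m) * (bargmann_weight q \<xi> * (h (Suc m) \<xi> * h n \<xi>))
         = (1 - q ^ Suc n) * (bargmann_weight q \<xi> * (h m \<xi> * h (Suc n) \<xi>))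
       + bargmann_weight q \<xi> * (h m \<xi> * h' n \<xi>) - bargmann_weight q \<xi> * (h' m \<xi> * h n \<xi>)" by (simp only: mult_ac)
    qed
    also have "\<dots> = (1 - q ^ Suc n) * L (\<lambda>\<xi>. h m \<xi> * h (Suc n) \<xi>) + L (\<lambda>\<xi>. h m \<xi> * h' n \<xi>) - L (\<lambda>\<xi>. h' m \<xi> * h n \<xi>)"
      unfolding L_def using i by simp
    finally show ?thesis .
  qed
  have base: "L (\<lambda>\<xi>. h 0 \<xi> * h n \<xi>) = (if n = 0 then 1 else 0)" for n
    using bargmann_weight_q_hermite_integral(2)[OF q, of n] by (simp add: L_def h_def)
  have "\<forall>n. L (\<lambda>\<xi>. h m \<xi> * h n \<xi>) = (if m = n then euler_coeff q m else 0)"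
  proof (induction m rule: less_induct)
    case (less m)
    show ?case
    proof (cases m)
      case 0
      then show ?thesis using base by auto
    next
      case (Suc k)
      have IH: "L (\<lambda>\<xi>. h k \<xi> * h n \<xi>) = (if k = n then euler_coeff q k else 0)" for n
        using less.IH Suc by blast
      have IH': "L (\<lambda>\<xi>. h' k \<xi> * h n \<xi>) = (if k = Suc n then euler_coeff q n else 0)" for n
      proof (cases k)
        case 0 then show ?thesis by (simp add: h'_def L_def)
      next
        case (Suc j)
        then show ?thesis using less.IH \<open>m = Suc k\<close> by (auto simp: h'_def)
      qed
      have IH2: "L (\<lambda>\<xi>. h k \<xi> * h' n \<xi>) = (if Suc k = n then euler_coeff q k else 0)" for n
        using IH by (cases n) (auto simp: h'_def L_def)
      have "(1 - q ^ Suc k) * L (\<lambda>\<xi>. h (Suc k) \<xi> * h n \<xi>) = (1 - q ^ Suc k) * (if Suc k = n then euler_coeff q (Suc k) else 0)" for n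
        unfolding step IH IH' IH2 using euler_coeff_Suc[OF q, of k] euler_coeff_Suc[OF q, of n] by auto
      then show ?thesis using q_power_Suc_less_1[OF q, of k] unfolding mult_cancel_left Suc by auto
    qed
  qed
  then show ?thesis by (simp add: L_def h_def)
qed

section \<open>Parseval's equation from density\<close>

lemma integrable_mult_L2:
  fixes f g :: "'a \<Rightarrow> real"
  assumes [measurable]: "f \<in> borel_measurable M" "g \<in> borel_measurable M"
    and "integrable M (\<lambda>x. (f x)\<^sup>2)" "integrable M (\<lambda>x. (g x)\<^sup>2)"
  shows "integrable M (\<lambda>x. f x * g x)"
proof (rule Bochner_Integration.integrable_bound[of _ "\<lambda>x. (f x)\<^sup>2 + (g x)\<^sup>2"])
  show "AE x in M. norm (f x * g x) \<le> norm ((f x)\<^sup>2 + (g x)\<^sup>2)"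
  proof (rule AE_I2)
    fix x
    have "2 * \<bar>f x * g x\<bar> \<le> (f x)\<^sup>2 + (g x)\<^sup>2"
      using sum_squares_bound[of "\<bar>f x\<bar>" "\<bar>g x\<bar>"] by (simp add: abs_mult)
    then show "norm (f x * g x) \<le> norm ((f x)\<^sup>2 + (g x)\<^sup>2)" by simp
  qed
qed (use assms in auto)

text \<open>
  Completing the square in the coefficients.  For \<open>\<beta> n\<close> the Fourier coefficient this is Bessel's identity;
  in general it shows that no other linear combination comes closer to \<open>f\<close>.
\<close>

lemma L2_distance_orthonormal:
  fixes \<phi> :: "nat \<Rightarrow> 'a \<Rightarrow> real"
  assumes [measurable]: "\<And>n. \<phi> n \<in> borel_measurable M" "f \<in> borel_measurable M"
    and sq: "\<And>n. integrable M (\<lambda>x. (\<phi> n x)\<^sup>2)" "integrable M (\<lambda>x. (f x)\<^sup>2)"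
    and orth: "\<And>m n. (\<integral>x. \<phi> m x * \<phi> n x \<partial>M) = (if m = n then 1 else 0)"
  shows "(\<integral>x. (f x - (\<Sum>n\<le>d. \<beta> n * \<phi> n x))\<^sup>2 \<partial>M)
     = (\<integral>x. (f x)\<^sup>2 \<partial>M) - (\<Sum>n\<le>d. (\<integral>x. \<phi> n x * f x \<partial>M)\<^sup>2) + (\<Sum>n\<le>d. (\<beta> n - (\<integral>x. \<phi> n x * f x \<partial>M))\<^sup>2)"
proof -
  have i1: "integrable M (\<lambda>x. \<phi> n x * f x)" "integrable M (\<lambda>x. \<phi> m x * \<phi> n x)" for m n
    by (intro integrable_mult_L2 sq; simp)+
  have "(f x - (\<Sum>n\<le>d. \<beta> n * \<phi> n x))\<^sup>2 = (f x)\<^sup>2 - (\<Sum>n\<le>d. 2 * \<beta> n * (\<phi> n x * f x))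
      + (\<Sum>m\<le>d. \<Sum>n\<le>d. \<beta> m * \<beta> n * (\<phi> m x * \<phi> n x))" for x
  proof -
    have "(f x - (\<Sum>n\<le>d. \<beta> n * \<phi> n x))\<^sup>2 = (f x)\<^sup>2 - 2 * f x * (\<Sum>n\<le>d. \<beta> n * \<phi> n x)
       + (\<Sum>n\<le>d. \<beta> n * \<phi> n x) * (\<Sum>n\<le>d. \<beta> n * \<phi> n x)"
      by (simp add: power2_eq_square algebra_simps)
    then show ?thesis unfolding sum_product by (simp add: sum_distrib_left mult_ac)
  qed
  then have "(\<integral>x. (f x - (\<Sum>n\<le>d. \<beta> n * \<phi> n x))\<^sup>2 \<partial>M) = (\<integral>x. (f x)\<^sup>2 \<partial>M)
      - (\<Sum>n\<le>d. 2 * \<beta> n * (\<integral>x. \<phi> n x * f x \<partial>M)) + (\<Sum>m\<le>d. \<Sum>n\<le>d. \<beta> m * \<beta> n * (\<integral>x. \<phi> m x * \<phi> n x \<partial>M))"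
    using i1 sq by simp
  also have "(\<Sum>m\<le>d. \<Sum>n\<le>d. \<beta> m * \<beta> n * (\<integral>x. \<phi> m x * \<phi> n x \<partial>M)) = (\<Sum>m\<le>d. (\<beta> m)\<^sup>2)"
    unfolding orth by (intro sum.cong refl) (simp add: power2_eq_square if_distrib[of "\<lambda>c. _ * c"] sum.delta cong: if_cong)
  finally show ?thesis
    by (simp add: power2_diff sum.distrib sum_subtractf sum_distrib_left mult_ac)
qed

lemma parseval_if_dense:
  fixes \<phi> :: "nat \<Rightarrow> 'a \<Rightarrow> real"
  assumes meas: "\<And>n. \<phi> n \<in> borel_measurable M" "f \<in> borel_measurable M"
    and sq: "\<And>n. integrable M (\<lambda>x. (\<phi> n x)\<^sup>2)" "integrable M (\<lambda>x. (f x)\<^sup>2)"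
    and orth: "\<And>m n. (\<integral>x. \<phi> m x * \<phi> n x \<partial>M) = (if m = n then 1 else 0)"
    and dense: "\<And>\<epsilon>. \<epsilon> > 0 \<Longrightarrow> \<exists>d \<beta>. (\<integral>x. (f x - (\<Sum>n\<le>d. \<beta> n * \<phi> n x))\<^sup>2 \<partial>M) < \<epsilon>"
  shows "(\<lambda>n. (\<integral>x. \<phi> n x * f x \<partial>M)\<^sup>2) sums (\<integral>x. (f x)\<^sup>2 \<partial>M)"
proof -
  define c where "c n = (\<integral>x. \<phi> n x * f x \<partial>M)" for n
  define F where "F = (\<integral>x. (f x)\<^sup>2 \<partial>M)"
  note dist = L2_distance_orthonormal[OF meas sq orth, folded c_def F_def]
  have le: "(\<Sum>n\<le>d. (c n)\<^sup>2) \<le> F" for d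
  proof -
    have "0 \<le> (\<integral>x. (f x - (\<Sum>n\<le>d. c n * \<phi> n x))\<^sup>2 \<partial>M)" by simp
    then show ?thesis unfolding dist by simp
  qed
  have "(\<lambda>d. \<Sum>n\<le>d. (c n)\<^sup>2) \<longlonglongrightarrow> F"
  proof (rule LIMSEQ_I)
    fix \<epsilon> :: real assume "\<epsilon> > 0"
    then obtain d \<beta> where "(\<integral>x. (f x - (\<Sum>n\<le>d. \<beta> n * \<phi> n x))\<^sup>2 \<partial>M) < \<epsilon>" using dense by blast
    then have "F - (\<Sum>n\<le>d. (c n)\<^sup>2) < \<epsilon>"
      unfolding dist using sum_nonneg[of "{..d}" "\<lambda>n. (\<beta> n - c n)\<^sup>2"] by simp
    moreover have "(\<Sum>n\<le>d. (c n)\<^sup>2) \<le> (\<Sum>n\<le>D. (c n)\<^sup>2)" if "d \<le> D" for D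
      using that by (intro sum_mono2) auto
    ultimately have "norm ((\<Sum>n\<le>D. (c n)\<^sup>2) - F) < \<epsilon>" if "d \<le> D" for D
      using le[of D] that by (smt (verit) real_norm_def)
    then show "\<exists>d. \<forall>D\<ge>d. norm ((\<Sum>n\<le>D. (c n)\<^sup>2) - F) < \<epsilon>" by blast
  qed
  then show ?thesis unfolding c_def F_def by (simp add: sums_def_le)
qed

section \<open>Completeness of the q-Hermite functions\<close>

text \<open>
  Requiring the representation for all large upper limits forces \<open>b\<close> to vanish beyond \<open>d\<close> when
  \<open>0 < q < 1\<close>, so two
  representations can be added without padding.
\<close>

definition in_q_hermite_span :: "real \<Rightarrow> (real \<Rightarrow> real) \<Rightarrow> bool" where
  "in_q_hermite_span q p \<longleftrightarrow> (\<exists>d b. \<forall>D\<ge>d. \<forall>x. p x = (\<Sum>n\<le>D. b n * q_hermite q n x))"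

lemma in_q_hermite_span_q_hermite: "in_q_hermite_span q (\<lambda>x. c * q_hermite q m x)"
  unfolding in_q_hermite_span_def
  by (intro exI[of _ m] exI[of _ "\<lambda>n. if n = m then c else 0"])
    (auto simp: if_distrib[of "\<lambda>c. c * _"] sum.delta cong: if_cong)

lemma in_q_hermite_span_add:
  assumes "in_q_hermite_span q f" "in_q_hermite_span q g"
  shows "in_q_hermite_span q (\<lambda>x. f x + g x)"
proof -
  obtain d b where f: "\<And>D x. D \<ge> d \<Longrightarrow> f x = (\<Sum>n\<le>D. b n * q_hermite q n x)"
    using assms(1) unfolding in_q_hermite_span_def by blast
  obtain d' b' where g: "\<And>D x. D \<ge> d' \<Longrightarrow> g x = (\<Sum>n\<le>D. b' n * q_hermite q n x)"
    using assms(2) unfolding in_q_hermite_span_def by blast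
  have "f x + g x = (\<Sum>n\<le>D. (b n + b' n) * q_hermite q n x)" if "D \<ge> max d d'" for D x
    using that unfolding distrib_right sum.distrib by (subst f[of D], simp, subst g[of D], simp_all)
  then show ?thesis unfolding in_q_hermite_span_def
    by (intro exI[of _ "max d d'"] exI[of _ "\<lambda>n. b n + b' n"]) blast
qed

lemma in_q_hermite_span_sum:
  "(\<And>i. i \<in> A \<Longrightarrow> in_q_hermite_span q (f i)) \<Longrightarrow> in_q_hermite_span q (\<lambda>x. \<Sum>i\<in>A. f i x)"
proof (induction A rule: infinite_finite_induct)
  case (insert i A)
  then show ?case by (simp add: in_q_hermite_span_add)
qed (use in_q_hermite_span_q_hermite[of q 0] in simp_all)

lemma in_q_hermite_span_mult_x:
  assumes q: "0 < q" "q < 1" and f: "in_q_hermite_span q f"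
  shows "in_q_hermite_span q (\<lambda>x. x * f x)"
proof -
  obtain d b where f: "\<And>x. f x = (\<Sum>n\<le>d. b n * q_hermite q n x)" using f unfolding in_q_hermite_span_def by blast
  have "in_q_hermite_span q (\<lambda>x. b n * (x * q_hermite q n x))" for n
  proof (cases n)
    case 0
    have eq: "b n * (x * q_hermite q n x) = b n * (1 - q) / 2 * q_hermite q (Suc 0) x" for x
      using 0 q by (simp add: field_simps)
    show ?thesis unfolding eq by (rule in_q_hermite_span_q_hermite)
  next
    case (Suc m)
    have eq: "b n * (x * q_hermite q n x) = b n * (1 - q ^ Suc (Suc m)) / 2 * q_hermite q (Suc (Suc m)) x + b n / 2 * q_hermite q m x" for x
    proof -
      have "b n * (1 - q ^ Suc (Suc m)) / 2 * q_hermite q (Suc (Suc m)) x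
          = b n / 2 * ((1 - q ^ Suc (Suc m)) * q_hermite q (Suc (Suc m)) x)" by (simp only: times_divide_eq_left mult.assoc)
      then show ?thesis unfolding q_hermite_recurrence[OF q] Suc by (simp add: field_simps del: q_hermite.simps)
    qed
    show ?thesis unfolding eq by (intro in_q_hermite_span_add in_q_hermite_span_q_hermite)
  qed
  then have "in_q_hermite_span q (\<lambda>x. \<Sum>n\<le>d. b n * (x * q_hermite q n x))" by (intro in_q_hermite_span_sum)
  then show ?thesis by (simp add: f sum_distrib_left mult_ac)
qed

lemma in_q_hermite_span_polynomial:
  assumes q: "0 < q" "q < 1"
  shows "in_q_hermite_span q (\<lambda>x. \<Sum>i\<le>d. a i * x ^ i)"
proof -
  have "in_q_hermite_span q (\<lambda>x. c * x ^ i)" for c i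
  proof (induction i)
    case 0
    then show ?case using in_q_hermite_span_q_hermite[of q c 0] by simp
  next
    case (Suc i)
    then show ?case using in_q_hermite_span_mult_x[OF q Suc] by (simp add: mult_ac)
  qed
  then show ?thesis by (intro in_q_hermite_span_sum)
qed

definition hermite_fun :: "real \<Rightarrow> nat \<Rightarrow> real \<Rightarrow> real" where
  "hermite_fun q n \<xi> = sqrt (q_pochhammer q q n) * q_hermite q n (unit_coord q \<xi>) * sqrt (bargmann_weight q \<xi>)"

context
  fixes q :: real assumes q: "0 < q" "q < 1"
begin

lemma bargmann_weight_integrable: "integrable (lebesgue_on (q_interval q)) (bargmann_weight q)"
  and bargmann_weight_integral: "(\<integral>\<xi>. bargmann_weight q \<xi> \<partial>lebesgue_on (q_interval q)) = 1"
  using bargmann_weight_q_hermite_integral[OF q, of 0] by simp_all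

lemma bargmann_weight_measurable [measurable]: "bargmann_weight q \<in> borel_measurable (lebesgue_on (q_interval q))"
  using bargmann_weight_integrable by simp

lemma continuous_measurable_q_interval:
  fixes p :: "real \<Rightarrow> real"
  assumes "continuous_on UNIV p" shows "p \<in> borel_measurable (lebesgue_on (q_interval q))"
  by (rule continuous_imp_measurable_on_sets_lebesgue[OF continuous_on_subset[OF assms]]) auto

lemma hermite_fun_measurable [measurable]: "hermite_fun q n \<in> borel_measurable (lebesgue_on (q_interval q))"
proof -
  have [measurable]: "(\<lambda>\<xi>. q_hermite q n (unit_coord q \<xi>)) \<in> borel_measurable (lebesgue_on (q_interval q))"
    by (intro continuous_measurable_q_interval continuous_intros)
  show ?thesis unfolding hermite_fun_def[abs_def] by measurable
qed

lemma hermite_fun_mult: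
  assumes "\<xi> \<in> q_interval q"
  shows "hermite_fun q m \<xi> * hermite_fun q n \<xi> =
     sqrt (q_pochhammer q q m) * sqrt (q_pochhammer q q n) *
       (bargmann_weight q \<xi> * (q_hermite q m (unit_coord q \<xi>) * q_hermite q n (unit_coord q \<xi>)))"
proof -
  have "sqrt (bargmann_weight q \<xi>) * sqrt (bargmann_weight q \<xi>) = bargmann_weight q \<xi>" using bargmann_weight_pos[OF q assms] by simp
  moreover have "hermite_fun q m \<xi> * hermite_fun q n \<xi> = sqrt (q_pochhammer q q m) * sqrt (q_pochhammer q q n) *
       ((sqrt (bargmann_weight q \<xi>) * sqrt (bargmann_weight q \<xi>)) * (q_hermite q m (unit_coord q \<xi>) * q_hermite q n (unit_coord q \<xi>)))"
    by (simp only: hermite_fun_def mult_ac)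
  ultimately show ?thesis by simp
qed

lemma hermite_fun_integrable: "integrable (lebesgue_on (q_interval q)) (\<lambda>\<xi>. hermite_fun q m \<xi> * hermite_fun q n \<xi>)"
proof -
  let ?g = "\<lambda>\<xi>. sqrt (q_pochhammer q q m) * sqrt (q_pochhammer q q n) *
       (bargmann_weight q \<xi> * (q_hermite q m (unit_coord q \<xi>) * q_hermite q n (unit_coord q \<xi>)))"
  have "integrable (lebesgue_on (q_interval q)) (\<lambda>\<xi>. bargmann_weight q \<xi> * (q_hermite q m (unit_coord q \<xi>) * q_hermite q n (unit_coord q \<xi>)))"
    by (rule integrable_bargmann_weight_continuous[OF q]) (intro continuous_intros)
  then have "integrable (lebesgue_on (q_interval q)) ?g" by simp
  moreover have "integrable (lebesgue_on (q_interval q)) (\<lambda>\<xi>. hermite_fun q m \<xi> * hermite_fun q n \<xi>)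
      \<longleftrightarrow> integrable (lebesgue_on (q_interval q)) ?g"
    by (rule Bochner_Integration.integrable_cong[OF refl]) (rule hermite_fun_mult, simp)
  ultimately show ?thesis by blast
qed

lemma hermite_fun_orthonormal:
  "(\<integral>\<xi>. hermite_fun q m \<xi> * hermite_fun q n \<xi> \<partial>lebesgue_on (q_interval q)) = (if m = n then 1 else 0)"
proof -
  have "(\<integral>\<xi>. hermite_fun q m \<xi> * hermite_fun q n \<xi> \<partial>lebesgue_on (q_interval q)) =
     (\<integral>\<xi>. sqrt (q_pochhammer q q m) * sqrt (q_pochhammer q q n) *
       (bargmann_weight q \<xi> * (q_hermite q m (unit_coord q \<xi>) * q_hermite q n (unit_coord q \<xi>))) \<partial>lebesgue_on (q_interval q))"
    by (rule Bochner_Integration.integral_cong[OF refl]) (rule hermite_fun_mult, simp)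
  also have "\<dots> = sqrt (q_pochhammer q q m) * sqrt (q_pochhammer q q n) * (if m = n then euler_coeff q m else 0)"
    by (subst integral_mult_right_zero) (simp only: q_hermite_orthogonal[OF q])
  also have "\<dots> = (if m = n then 1 else 0)"
    using q_pochhammer_pos[OF q, of n] by (auto simp: euler_coeff_def)
  finally show ?thesis .
qed

lemma hermite_fun_square_integrable: "integrable (lebesgue_on (q_interval q)) (\<lambda>\<xi>. (hermite_fun q n \<xi>)\<^sup>2)"
  using hermite_fun_integrable[of n n] by (simp add: power2_eq_square)

text \<open>
  Dominated convergence with \<open>f^2\<close> as dominating function.  Truncation is applied to \<open>f\<close> divided by the
  root of the weight, because that quotient is what the polynomials have to approximate in the weighted space.
\<close>

lemma L2_truncation_small:
  fixes f :: "real \<Rightarrow> real"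
  assumes f [measurable]: "f \<in> borel_measurable (lebesgue_on (q_interval q))"
    and f2: "integrable (lebesgue_on (q_interval q)) (\<lambda>\<xi>. (f \<xi>)\<^sup>2)" and "\<epsilon> > 0"
  shows "\<exists>K\<ge>0. (\<integral>\<xi>. (f \<xi> - max (- K) (min K (f \<xi> / sqrt (bargmann_weight q \<xi>))) * sqrt (bargmann_weight q \<xi>))\<^sup>2 \<partial>lebesgue_on (q_interval q)) < \<epsilon>"
proof -
  let ?M = "lebesgue_on (q_interval q)"
  define g where "g K \<xi> = (f \<xi> - max (- real K) (min (real K) (f \<xi> / sqrt (bargmann_weight q \<xi>))) * sqrt (bargmann_weight q \<xi>))\<^sup>2" for K \<xi>
  have "(\<lambda>K. integral\<^sup>L ?M (g K)) \<longlonglongrightarrow> integral\<^sup>L ?M (\<lambda>_. 0)"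
  proof (rule integral_dominated_convergence[where w = "\<lambda>\<xi>. (f \<xi>)\<^sup>2"])
    show "g K \<in> borel_measurable ?M" for K unfolding g_def[abs_def] by measurable
    have s: "sqrt (bargmann_weight q \<xi>) > 0" "f \<xi> = f \<xi> / sqrt (bargmann_weight q \<xi>) * sqrt (bargmann_weight q \<xi>)" if "\<xi> \<in> space ?M" for \<xi>
      using bargmann_weight_pos[OF q, of \<xi>] that by auto
    show "AE \<xi> in ?M. (\<lambda>K. g K \<xi>) \<longlonglongrightarrow> 0"
    proof (rule AE_I2)
      fix \<xi> assume xi: "\<xi> \<in> space ?M"
      have "\<forall>\<^sub>F K in sequentially. g K \<xi> = 0"
        using eventually_ge_at_top[of "nat \<lceil>\<bar>f \<xi> / sqrt (bargmann_weight q \<xi>)\<bar>\<rceil>"]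
      proof eventually_elim
        case (elim K)
        then have "\<bar>f \<xi> / sqrt (bargmann_weight q \<xi>)\<bar> \<le> real K" by linarith
        then have "max (- real K) (min (real K) (f \<xi> / sqrt (bargmann_weight q \<xi>))) = f \<xi> / sqrt (bargmann_weight q \<xi>)" by linarith
        then show ?case using s[OF xi] by (simp add: g_def)
      qed
      then show "(\<lambda>K. g K \<xi>) \<longlonglongrightarrow> 0" by (rule tendsto_eventually)
    qed
    show "AE \<xi> in ?M. norm (g K \<xi>) \<le> (f \<xi>)\<^sup>2" for K
    proof (rule AE_I2)
      fix \<xi> assume xi: "\<xi> \<in> space ?M"
      define h where "h = f \<xi> / sqrt (bargmann_weight q \<xi>)"
      have "(h - max (- real K) (min (real K) h))\<^sup>2 \<le> h\<^sup>2"
        by (rule abs_le_square_iff[THEN iffD1]) linarith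
      then have "((h - max (- real K) (min (real K) h)) * sqrt (bargmann_weight q \<xi>))\<^sup>2 \<le> (h * sqrt (bargmann_weight q \<xi>))\<^sup>2"
        unfolding power_mult_distrib by (rule mult_right_mono) simp
      then show "norm (g K \<xi>) \<le> (f \<xi>)\<^sup>2"
        using s[OF xi] by (simp add: g_def h_def[symmetric] left_diff_distrib)
    qed
  qed (use f2 in auto)
  then have "(\<lambda>K. integral\<^sup>L ?M (g K)) \<longlonglongrightarrow> 0" by simp
  from order_tendstoD(2)[OF this \<open>\<epsilon> > 0\<close>] obtain K where "integral\<^sup>L ?M (g K) < \<epsilon>"
    using eventually_happens by force
  then show ?thesis unfolding g_def by (intro exI[of _ "real K"]) auto
qed

text \<open>
  A Lebesgue measurable function is an almost everywhere limit of continuous functions; clipping these at the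
  bound of \<open>h\<close> makes the convergence dominated, since the weight is integrable.
\<close>

lemma bounded_continuous_approx:
  fixes h :: "real \<Rightarrow> real"
  assumes h: "h \<in> borel_measurable (lebesgue_on (q_interval q))" and hK: "\<And>\<xi>. \<bar>h \<xi>\<bar> \<le> K" and "\<epsilon> > 0"
  shows "\<exists>g. continuous_on UNIV g \<and> (\<integral>\<xi>. bargmann_weight q \<xi> * (h \<xi> - g \<xi>)\<^sup>2 \<partial>lebesgue_on (q_interval q)) < \<epsilon>"
proof -
  let ?M = "lebesgue_on (q_interval q)"
  have "(\<lambda>\<xi>. if \<xi> \<in> q_interval q then h \<xi> else 0) \<in> borel_measurable lebesgue"
    using h by (subst borel_measurable_if) auto
  from lebesgue_measurable_imp_measurable_on[OF this, of UNIV]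
  obtain N g where N: "negligible N" and cg: "\<And>n. continuous_on UNIV (g n)"
    and lim: "\<And>x. x \<notin> N \<Longrightarrow> (\<lambda>n. g n x) \<longlonglongrightarrow> (if x \<in> q_interval q then h x else 0)"
    unfolding measurable_on_def by auto
  define g' where "g' n \<xi> = max (- K) (min K (g n \<xi>))" for n \<xi>
  have cg': "continuous_on UNIV (g' n)" for n unfolding g'_def by (intro continuous_intros cg)
  note [measurable] = continuous_measurable_q_interval[OF cg'] h
  have AEN: "AE \<xi> in ?M. \<xi> \<notin> N"
  proof -
    have "AE \<xi> in lebesgue. \<xi> \<notin> N"
      using N negligible_iff_null_sets AE_not_in by blast
    then have "AE \<xi> in lebesgue. \<xi> \<in> q_interval q \<longrightarrow> \<xi> \<notin> N" by eventually_elim auto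
    then show ?thesis by (simp add: AE_restrict_space_iff)
  qed
  have "(\<lambda>n. \<integral>\<xi>. bargmann_weight q \<xi> * (h \<xi> - g' n \<xi>)\<^sup>2 \<partial>?M) \<longlonglongrightarrow> integral\<^sup>L ?M (\<lambda>_. 0)"
  proof (rule integral_dominated_convergence[where w = "\<lambda>\<xi>. bargmann_weight q \<xi> * (2 * K)\<^sup>2"])
    show "AE \<xi> in ?M. (\<lambda>n. bargmann_weight q \<xi> * (h \<xi> - g' n \<xi>)\<^sup>2) \<longlonglongrightarrow> 0"
      using AEN AE_space
    proof eventually_elim
      case (elim \<xi>)
      have "(\<lambda>n. g n \<xi>) \<longlonglongrightarrow> h \<xi>" using lim[OF elim(1)] elim(2) by simp
      then have "(\<lambda>n. bargmann_weight q \<xi> * (h \<xi> - g' n \<xi>)\<^sup>2) \<longlonglongrightarrow> bargmann_weight q \<xi> * (h \<xi> - max (- K) (min K (h \<xi>)))\<^sup>2"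
        unfolding g'_def by (intro tendsto_intros)
      moreover have "max (- K) (min K (h \<xi>)) = h \<xi>" using hK[of \<xi>] by linarith
      ultimately show ?case by simp
    qed
    show "AE \<xi> in ?M. norm (bargmann_weight q \<xi> * (h \<xi> - g' n \<xi>)\<^sup>2) \<le> bargmann_weight q \<xi> * (2 * K)\<^sup>2" for n
    proof (rule AE_I2)
      fix \<xi> assume "\<xi> \<in> space ?M"
      then have "bargmann_weight q \<xi> > 0" using bargmann_weight_pos[OF q] by simp
      moreover have "\<bar>h \<xi> - g' n \<xi>\<bar> \<le> \<bar>2 * K\<bar>" using hK[of \<xi>] unfolding g'_def by linarith
      then have "(h \<xi> - g' n \<xi>)\<^sup>2 \<le> (2 * K)\<^sup>2" by (rule abs_le_square_iff[THEN iffD1])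
      ultimately show "norm (bargmann_weight q \<xi> * (h \<xi> - g' n \<xi>)\<^sup>2) \<le> bargmann_weight q \<xi> * (2 * K)\<^sup>2"
        by (simp add: abs_mult)
    qed
  qed (use bargmann_weight_integrable in auto)
  then have "(\<lambda>n. \<integral>\<xi>. bargmann_weight q \<xi> * (h \<xi> - g' n \<xi>)\<^sup>2 \<partial>?M) \<longlonglongrightarrow> 0" by simp
  from order_tendstoD(2)[OF this \<open>\<epsilon> > 0\<close>] obtain n where "(\<integral>\<xi>. bargmann_weight q \<xi> * (h \<xi> - g' n \<xi>)\<^sup>2 \<partial>?M) < \<epsilon>"
    using eventually_happens by force
  then show ?thesis using cg' by blast
qed

text \<open>
  Three approximations, each with squared error at most \<open>\<epsilon> / 9\<close>, combined by
  \<open>(x + y + z)^2 \<le> 3 x^2 + 3 y^2 + 3 z^2\<close>: truncate \<open>f / sqrt (bargmann_weight q \<xi>)\<close>, replace it by a continuous function, and that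
  by a polynomial.
\<close>

lemma hermite_fun_dense:
  fixes f :: "real \<Rightarrow> real"
  assumes f [measurable]: "f \<in> borel_measurable (lebesgue_on (q_interval q))"
    and f2: "integrable (lebesgue_on (q_interval q)) (\<lambda>\<xi>. (f \<xi>)\<^sup>2)" and eps: "\<epsilon> > 0"
  shows "\<exists>d \<beta>. (\<integral>\<xi>. (f \<xi> - (\<Sum>n\<le>d. \<beta> n * hermite_fun q n \<xi>))\<^sup>2 \<partial>lebesgue_on (q_interval q)) < \<epsilon>"
proof -
  let ?M = "lebesgue_on (q_interval q)"
  define s where "s \<xi> = sqrt (bargmann_weight q \<xi>)" for \<xi>
  have s_sq: "(s \<xi>)\<^sup>2 = bargmann_weight q \<xi>" if "\<xi> \<in> q_interval q" for \<xi>
    using bargmann_weight_pos[OF q that] by (simp add: s_def)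
  have [measurable]: "s \<in> borel_measurable ?M" unfolding s_def[abs_def] by measurable
  obtain K where K: "K \<ge> 0" "(\<integral>\<xi>. (f \<xi> - max (- K) (min K (f \<xi> / s \<xi>)) * s \<xi>)\<^sup>2 \<partial>?M) < \<epsilon> / 9"
    using L2_truncation_small[OF f f2, of "\<epsilon> / 9"] eps by (auto simp: s_def)
  define h where "h \<xi> = max (- K) (min K (f \<xi> / s \<xi>))" for \<xi>
  have hK: "\<bar>h \<xi>\<bar> \<le> K" for \<xi> using K(1) by (auto simp: h_def)
  have h [measurable]: "h \<in> borel_measurable ?M" unfolding h_def[abs_def] by measurable
  obtain g where cg: "continuous_on UNIV g" and g: "(\<integral>\<xi>. bargmann_weight q \<xi> * (h \<xi> - g \<xi>)\<^sup>2 \<partial>?M) < \<epsilon> / 9"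
    using bounded_continuous_approx[OF h hK, of "\<epsilon> / 9"] eps by auto
  note [measurable] = continuous_measurable_q_interval[OF cg]
  define c where "c = sqrt 2 / sqrt (1 - q)"
  have c: "c > 0" using q by (simp add: c_def)
  have "continuous_on {-c..c} g" by (rule continuous_on_subset[OF cg]) simp
  then obtain p where p: "real_polynomial_function p" "\<And>\<xi>. \<xi> \<in> {-c..c} \<Longrightarrow> \<bar>g \<xi> - p \<xi>\<bar> < sqrt \<epsilon> / 3"
    using Stone_Weierstrass_real_polynomial_function[of "{-c..c}" g "sqrt \<epsilon> / 3"] eps by auto
  obtain a d where a: "p = (\<lambda>\<xi>. \<Sum>i\<le>d. a i * \<xi> ^ i)" using real_polynomial_function_imp_sum[OF p(1)] by blast
  obtain D b where b: "\<And>x. (\<Sum>i\<le>d. (a i * c ^ i) * x ^ i) = (\<Sum>n\<le>D. b n * q_hermite q n x)"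
    using in_q_hermite_span_polynomial[OF q, where d = d and a = "\<lambda>i. a i * c ^ i"] unfolding in_q_hermite_span_def by blast
  have p_eq: "p \<xi> = (\<Sum>n\<le>D. b n * q_hermite q n (unit_coord q \<xi>))" for \<xi>
  proof -
    have "\<xi> = c * unit_coord q \<xi>" using q by (simp add: c_def unit_coord_def)
    then have "p \<xi> = (\<Sum>i\<le>d. a i * (c * unit_coord q \<xi>) ^ i)" unfolding a by (rule arg_cong)
    then show ?thesis using b[of "unit_coord q \<xi>"] by (simp add: power_mult_distrib mult_ac)
  qed
  define \<beta> where "\<beta> n = b n / sqrt (q_pochhammer q q n)" for n
  have ps: "(\<Sum>n\<le>D. \<beta> n * hermite_fun q n \<xi>) = p \<xi> * s \<xi>" for \<xi>
    unfolding p_eq sum_distrib_right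
    using q_pochhammer_pos[OF q] by (intro sum.cong refl) (simp add: \<beta>_def hermite_fun_def s_def less_imp_neq[symmetric])
  have cp: "continuous_on UNIV p" unfolding a by (intro continuous_intros)
  have i1: "integrable ?M (\<lambda>\<xi>. (f \<xi> - h \<xi> * s \<xi>)\<^sup>2)"
  proof (rule Bochner_Integration.integrable_bound[of _ "\<lambda>\<xi>. 2 * (f \<xi>)\<^sup>2 + 2 * K\<^sup>2 * bargmann_weight q \<xi>"])
    show "integrable ?M (\<lambda>\<xi>. 2 * (f \<xi>)\<^sup>2 + 2 * K\<^sup>2 * bargmann_weight q \<xi>)"
      using f2 bargmann_weight_integrable by simp
    show "AE \<xi> in ?M. norm ((f \<xi> - h \<xi> * s \<xi>)\<^sup>2) \<le> norm (2 * (f \<xi>)\<^sup>2 + 2 * K\<^sup>2 * bargmann_weight q \<xi>)"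
    proof (rule AE_I2)
      fix \<xi> assume "\<xi> \<in> space ?M"
      then have xi: "\<xi> \<in> q_interval q" by simp
      have "(x - y)\<^sup>2 \<le> 2 * x\<^sup>2 + 2 * y\<^sup>2" for x y :: real
        using zero_le_power2[of "x + y"] by (simp add: power2_eq_square algebra_simps)
      then have "(f \<xi> - h \<xi> * s \<xi>)\<^sup>2 \<le> 2 * (f \<xi>)\<^sup>2 + 2 * (h \<xi> * s \<xi>)\<^sup>2" .
      also have "(h \<xi> * s \<xi>)\<^sup>2 \<le> K\<^sup>2 * bargmann_weight q \<xi>"
        unfolding power_mult_distrib s_sq[OF xi] using bargmann_weight_pos[OF q xi] hK[of \<xi>] K(1)
        by (intro mult_right_mono) (auto intro: power2_le_iff_abs_le[THEN iffD2])
      finally show "norm ((f \<xi> - h \<xi> * s \<xi>)\<^sup>2) \<le> norm (2 * (f \<xi>)\<^sup>2 + 2 * K\<^sup>2 * bargmann_weight q \<xi>)" by simp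
    qed
  qed measurable
  have i2: "integrable ?M (\<lambda>\<xi>. bargmann_weight q \<xi> * (h \<xi> - g \<xi>)\<^sup>2)"
  proof (rule Bochner_Integration.integrable_bound[of _ "\<lambda>\<xi>. bargmann_weight q \<xi> * (K + \<bar>g \<xi>\<bar>)\<^sup>2"])
    show "integrable ?M (\<lambda>\<xi>. bargmann_weight q \<xi> * (K + \<bar>g \<xi>\<bar>)\<^sup>2)"
      by (rule integrable_bargmann_weight_continuous[OF q]) (intro continuous_intros cg)
    show "AE \<xi> in ?M. norm (bargmann_weight q \<xi> * (h \<xi> - g \<xi>)\<^sup>2) \<le> norm (bargmann_weight q \<xi> * (K + \<bar>g \<xi>\<bar>)\<^sup>2)"
    proof (rule AE_I2)
      fix \<xi>
      have "\<bar>h \<xi> - g \<xi>\<bar> \<le> \<bar>K + \<bar>g \<xi>\<bar>\<bar>" using hK[of \<xi>] K(1) by linarith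
      then have "(h \<xi> - g \<xi>)\<^sup>2 \<le> (K + \<bar>g \<xi>\<bar>)\<^sup>2" by (rule abs_le_square_iff[THEN iffD1])
      then show "norm (bargmann_weight q \<xi> * (h \<xi> - g \<xi>)\<^sup>2) \<le> norm (bargmann_weight q \<xi> * (K + \<bar>g \<xi>\<bar>)\<^sup>2)"
        by (simp add: abs_mult mult_left_mono)
    qed
  qed measurable
  have "(\<integral>\<xi>. (f \<xi> - p \<xi> * s \<xi>)\<^sup>2 \<partial>?M)
      \<le> (\<integral>\<xi>. 3 * (f \<xi> - h \<xi> * s \<xi>)\<^sup>2 + 3 * (bargmann_weight q \<xi> * (h \<xi> - g \<xi>)\<^sup>2) + \<epsilon> / 3 * bargmann_weight q \<xi> \<partial>?M)"
  proof (rule integral_mono')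
    show "integrable ?M (\<lambda>\<xi>. 3 * (f \<xi> - h \<xi> * s \<xi>)\<^sup>2 + 3 * (bargmann_weight q \<xi> * (h \<xi> - g \<xi>)\<^sup>2) + \<epsilon> / 3 * bargmann_weight q \<xi>)"
      using i1 i2 bargmann_weight_integrable by simp
    fix \<xi> assume "\<xi> \<in> space ?M"
    then have xi: "\<xi> \<in> q_interval q" by simp
    have v: "bargmann_weight q \<xi> > 0" by (rule bargmann_weight_pos[OF q xi])
    show "0 \<le> 3 * (f \<xi> - h \<xi> * s \<xi>)\<^sup>2 + 3 * (bargmann_weight q \<xi> * (h \<xi> - g \<xi>)\<^sup>2) + \<epsilon> / 3 * bargmann_weight q \<xi>"
      using v eps by (intro add_nonneg_nonneg mult_nonneg_nonneg) auto
    have sq3: "(x + y + z)\<^sup>2 \<le> 3 * x\<^sup>2 + 3 * y\<^sup>2 + 3 * z\<^sup>2" for x y z :: real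
      using zero_le_power2[of "x - y"] zero_le_power2[of "y - z"] zero_le_power2[of "x - z"]
      by (simp add: power2_eq_square algebra_simps)
    have "(f \<xi> - p \<xi> * s \<xi>)\<^sup>2 = ((f \<xi> - h \<xi> * s \<xi>) + (h \<xi> - g \<xi>) * s \<xi> + (g \<xi> - p \<xi>) * s \<xi>)\<^sup>2"
      by (simp add: algebra_simps)
    also have "\<dots> \<le> 3 * (f \<xi> - h \<xi> * s \<xi>)\<^sup>2 + 3 * ((h \<xi> - g \<xi>) * s \<xi>)\<^sup>2 + 3 * ((g \<xi> - p \<xi>) * s \<xi>)\<^sup>2"
      by (rule sq3)
    also have "((h \<xi> - g \<xi>) * s \<xi>)\<^sup>2 = bargmann_weight q \<xi> * (h \<xi> - g \<xi>)\<^sup>2"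
      by (simp add: power_mult_distrib s_sq[OF xi])
    also have "((g \<xi> - p \<xi>) * s \<xi>)\<^sup>2 \<le> \<epsilon> / 9 * bargmann_weight q \<xi>"
    proof -
      have "\<bar>g \<xi> - p \<xi>\<bar> \<le> \<bar>sqrt \<epsilon> / 3\<bar>" using p(2)[of \<xi>] xi eps by (auto simp: q_interval_def c_def)
      then have "(g \<xi> - p \<xi>)\<^sup>2 \<le> (sqrt \<epsilon> / 3)\<^sup>2" by (rule abs_le_square_iff[THEN iffD1])
      also have "\<dots> = \<epsilon> / 9" using eps by (simp add: power_divide)
      finally show ?thesis unfolding power_mult_distrib s_sq[OF xi] using v by (intro mult_right_mono) auto
    qed
    finally show "(f \<xi> - p \<xi> * s \<xi>)\<^sup>2 \<le> 3 * (f \<xi> - h \<xi> * s \<xi>)\<^sup>2 + 3 * (bargmann_weight q \<xi> * (h \<xi> - g \<xi>)\<^sup>2) + \<epsilon> / 3 * bargmann_weight q \<xi>"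
      by simp
  qed
  also have "\<dots> = 3 * (\<integral>\<xi>. (f \<xi> - h \<xi> * s \<xi>)\<^sup>2 \<partial>?M) + 3 * (\<integral>\<xi>. bargmann_weight q \<xi> * (h \<xi> - g \<xi>)\<^sup>2 \<partial>?M) + \<epsilon> / 3"
    using i1 i2 bargmann_weight_integrable bargmann_weight_integral by simp
  also have "\<dots> < \<epsilon>" using K(2) g unfolding h_def[symmetric] by linarith
  finally show ?thesis unfolding ps[symmetric] by blast
qed

lemma hermite_fun_parseval:
  fixes f :: "real \<Rightarrow> real"
  assumes f: "f \<in> borel_measurable (lebesgue_on (q_interval q))"
    and f2: "integrable (lebesgue_on (q_interval q)) (\<lambda>\<xi>. (f \<xi>)\<^sup>2)"
  shows "(\<lambda>n. (\<integral>\<xi>. hermite_fun q n \<xi> * f \<xi> \<partial>lebesgue_on (q_interval q))\<^sup>2) sums (\<integral>\<xi>. (f \<xi>)\<^sup>2 \<partial>lebesgue_on (q_interval q))"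
  by (rule parseval_if_dense[OF hermite_fun_measurable f hermite_fun_square_integrable f2 hermite_fun_orthonormal hermite_fun_dense[OF f f2]])

end

section \<open>The Bargmann transform\<close>

text \<open>
  The powers of \<open>1 - q\<close> in \<open>q_fact\<close> are those of \<open>t = sqrt (1 - q) * z\<close>, and the two roots of
  \<open>(q;q)_n\<close>, from normalizing in the \<open>L^2\<close> space and in the Arik--Coon space, make up for the
  \<open>(q;q)_n\<close> by which \<open>q_hermite\<close> is divided.
\<close>

lemma bargmann_kernel_sums:
  assumes q: "0 < q" "q < 1" and z: "z \<in> q_disc q" and \<xi>: "\<xi> \<in> q_interval q"
  shows "(\<lambda>n. of_real (hermite_fun q n \<xi>) * AC_basis q n z) sums q_bargmann_kernel q z \<xi>"
proof -
  define t where "t = z * of_real (sqrt (1 - q))"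
  have s: "sqrt (1 - q) > 0" "(sqrt (1 - q))\<^sup>2 = 1 - q" using q by auto
  have "(norm t)\<^sup>2 < 1"
    using z q by (simp add: t_def norm_mult power_mult_distrib q_disc_def mult.commute)
  then have t: "norm t < 1" by (simp add: abs_square_less_1)
  have x: "\<bar>unit_coord q \<xi>\<bar> \<le> 1" using unit_coord_less_1[OF q(2) \<xi>] by simp
  have 1: "2 * of_real (unit_coord q \<xi>) * t = complex_of_real (sqrt 2) * z * of_real \<xi> * of_real (1 - q)"
  proof -
    have "2 * unit_coord q \<xi> * sqrt (1 - q) = sqrt 2 * \<xi> * (1 - q)"
    proof -
      have rr: "sqrt (1 - q) * sqrt (1 - q) = 1 - q" using q by simp
      have "2 * unit_coord q \<xi> * sqrt (1 - q) = 2 / sqrt 2 * \<xi> * (sqrt (1 - q) * sqrt (1 - q))"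
        by (simp add: unit_coord_def)
      then show ?thesis unfolding rr by (simp add: real_div_sqrt)
    qed
    then have "complex_of_real (2 * unit_coord q \<xi> * sqrt (1 - q)) = of_real (sqrt 2 * \<xi> * (1 - q))" by (simp only:)
    then show ?thesis by (simp add: t_def mult_ac)
  qed
  have 2: "t\<^sup>2 = z\<^sup>2 * of_real (1 - q)"
    unfolding t_def power_mult_distrib by (simp only: of_real_power[symmetric] s(2))
  have "(\<lambda>n. of_real (sqrt (bargmann_weight q \<xi>)) * (of_real (q_hermite q n (unit_coord q \<xi>)) * t ^ n)) sums
      (of_real (sqrt (bargmann_weight q \<xi>)) * (\<Prod>k. 1 / (1 - 2 * of_real (unit_coord q \<xi>) * t * of_real (q ^ k) + t\<^sup>2 * of_real (q ^ (2 * k)))))"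
    by (intro sums_mult q_hermite_generating_function q t x)
  moreover have "of_real (sqrt (bargmann_weight q \<xi>)) * (of_real (q_hermite q n (unit_coord q \<xi>)) * t ^ n)
      = of_real (hermite_fun q n \<xi>) * AC_basis q n z" for n
  proof -
    have "sqrt (q_fact q n) = sqrt (q_pochhammer q q n) / sqrt (1 - q) ^ n"
      by (simp add: q_fact_def real_sqrt_divide real_sqrt_power)
    moreover have "sqrt (q_pochhammer q q n) > 0" using q_pochhammer_pos[OF q] by simp
    ultimately show ?thesis
      using s(1) by (simp add: hermite_fun_def AC_basis_def t_def power_mult_distrib)
  qed
  moreover have "of_real (sqrt (bargmann_weight q \<xi>)) * (\<Prod>k. 1 / (1 - 2 * of_real (unit_coord q \<xi>) * t * of_real (q ^ k) + t\<^sup>2 * of_real (q ^ (2 * k))))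
      = q_bargmann_kernel q z \<xi>"
    unfolding q_bargmann_kernel_def bargmann_weight_def 1 2 by (simp only: of_real_mult mult_ac)
  ultimately show ?thesis by (simp only:)
qed

lemma q_disc_larger:
  assumes q: "q < 1" and z: "z \<in> q_disc q"
  obtains w where "w \<in> q_disc q" "cmod z < cmod w"
proof -
  define R where "R = 1 / sqrt (1 - q)"
  define w where "w = (cmod z + R) / 2"
  have "cmod z < R" using z q by (simp add: q_disc_eq_ball R_def)
  then have "cmod z < w" "w < R" unfolding w_def by auto
  moreover from this have "w > 0" using norm_ge_zero[of z] by linarith
  ultimately have w: "cmod z < w" "w < R" "w > 0" by blast+
  then have "complex_of_real w \<in> q_disc q" using q by (simp add: q_disc_eq_ball R_def)
  then show ?thesis using w by (intro that[of "of_real w"]) auto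
qed

text \<open>
  A power series in \<open>z\<close> converges absolutely inside any larger disc on which it converges.
\<close>

lemma bargmann_kernel_summable:
  assumes q: "0 < q" "q < 1" and z: "z \<in> q_disc q" and \<xi>: "\<xi> \<in> q_interval q"
  shows "summable (\<lambda>n. norm (of_real (hermite_fun q n \<xi>) * AC_basis q n z))"
proof -
  obtain w where w: "w \<in> q_disc q" "norm z < norm w" using q_disc_larger[OF q(2) z] by blast
  have "summable (\<lambda>n. of_real (hermite_fun q n \<xi>) / complex_of_real (sqrt (q_fact q n)) * w ^ n)"
    using sums_summable[OF bargmann_kernel_sums[OF q w(1) \<xi>]] by (simp add: AC_basis_def)
  from powser_insidea[OF this w(2)] show ?thesis by (simp add: AC_basis_def)
qed

lemma summable_AC_basis:
  assumes q: "0 < q" "q < 1" and z: "z \<in> q_disc q"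
  shows "summable (\<lambda>j. cmod (AC_basis q j z))"
proof -
  obtain w where w: "w \<in> q_disc q" "norm z < norm w" using q_disc_larger[OF q(2) z] by blast
  from summable_LIMSEQ_zero[OF summable_AC_basis_sq[OF q w(1)]]
  have "(\<lambda>j. sqrt ((cmod (AC_basis q j w))\<^sup>2)) \<longlonglongrightarrow> sqrt 0" by (rule tendsto_real_sqrt)
  then have "(\<lambda>j. cmod (AC_basis q j w)) \<longlonglongrightarrow> 0" by simp
  then have "Bseq (\<lambda>j. cmod (AC_basis q j w))"
    by (rule convergent_imp_Bseq[OF convergentI])
  then obtain B where B: "\<And>j. cmod (AC_basis q j w) \<le> B" unfolding Bseq_def by auto
  have w0: "cmod w > 0" using w(2) norm_ge_zero[of z] by linarith
  show ?thesis
  proof (rule summable_comparison_test)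
    show "summable (\<lambda>j. B * (cmod z / cmod w) ^ j)"
      using w w0 by (intro summable_mult summable_geometric) simp
    have "cmod (AC_basis q j z) \<le> B * (cmod z / cmod w) ^ j" for j
    proof -
      have "cmod (AC_basis q j z) = cmod (AC_basis q j w) * (cmod z / cmod w) ^ j"
        using w0 by (simp add: AC_basis_def norm_divide norm_power power_divide)
      then show ?thesis using B[of j] w0 by (simp add: mult_right_mono)
    qed
    then show "\<exists>N. \<forall>j\<ge>N. norm (cmod (AC_basis q j z)) \<le> B * (cmod z / cmod w) ^ j" by simp
  qed
qed

context
  fixes q :: real and f :: "real \<Rightarrow> complex"
  assumes q: "0 < q" "q < 1" and f: "f \<in> L2_space q"
begin

lemma L2_space_measurable [measurable]: "f \<in> borel_measurable (lebesgue_on (q_interval q))"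
  and L2_space_square_integrable: "integrable (lebesgue_on (q_interval q)) (\<lambda>\<xi>. (cmod (f \<xi>))\<^sup>2)"
  using f by (auto simp: L2_space_def)

text \<open>
  The bound in the second part is uniform in \<open>n\<close>; together with \<open>summable_AC_basis\<close> it justifies
  integrating the expansion of the kernel termwise.
\<close>

lemma hermite_fun_L2_integrable:
  shows "integrable (lebesgue_on (q_interval q)) (\<lambda>\<xi>. of_real (hermite_fun q n \<xi>) * f \<xi>)"
    and "(\<integral>\<xi>. cmod (of_real (hermite_fun q n \<xi>) * f \<xi>) \<partial>lebesgue_on (q_interval q))
           \<le> 1 + (\<integral>\<xi>. (cmod (f \<xi>))\<^sup>2 \<partial>lebesgue_on (q_interval q))"
proof -
  let ?M = "lebesgue_on (q_interval q)"
  note [measurable] = hermite_fun_measurable[OF q]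
  have i: "integrable ?M (\<lambda>\<xi>. (hermite_fun q n \<xi>)\<^sup>2 + (cmod (f \<xi>))\<^sup>2)"
    by (intro Bochner_Integration.integrable_add hermite_fun_square_integrable[OF q] L2_space_square_integrable)
  have le: "cmod (of_real (hermite_fun q n \<xi>) * f \<xi>) \<le> (hermite_fun q n \<xi>)\<^sup>2 + (cmod (f \<xi>))\<^sup>2" for \<xi>
  proof -
    have "x * y \<le> x\<^sup>2 + y\<^sup>2" if "x \<ge> 0" "y \<ge> 0" for x y :: real
      using sum_squares_bound[of x y] mult_nonneg_nonneg[OF that] by linarith
    from this[of "\<bar>hermite_fun q n \<xi>\<bar>" "cmod (f \<xi>)"] show ?thesis by (simp add: norm_mult)
  qed
  show int: "integrable ?M (\<lambda>\<xi>. of_real (hermite_fun q n \<xi>) * f \<xi>)"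
    by (rule Bochner_Integration.integrable_bound[OF i])
      (use le in \<open>auto intro!: AE_I2 intro: order_trans[OF le]\<close>)
  have "(\<integral>\<xi>. cmod (of_real (hermite_fun q n \<xi>) * f \<xi>) \<partial>?M) \<le> (\<integral>\<xi>. (hermite_fun q n \<xi>)\<^sup>2 + (cmod (f \<xi>))\<^sup>2 \<partial>?M)"
    by (rule Bochner_Integration.integral_mono[OF integrable_norm[OF int] i le])
  also have "\<dots> = 1 + (\<integral>\<xi>. (cmod (f \<xi>))\<^sup>2 \<partial>?M)"
    using hermite_fun_square_integrable[OF q, of n] L2_space_square_integrable hermite_fun_orthonormal[OF q, of n n]
    by (simp add: power2_eq_square)
  finally show "(\<integral>\<xi>. cmod (of_real (hermite_fun q n \<xi>) * f \<xi>) \<partial>?M) \<le> 1 + (\<integral>\<xi>. (cmod (f \<xi>))\<^sup>2 \<partial>?M)" .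
qed

definition bargmann_coeff :: "nat \<Rightarrow> complex" where
  "bargmann_coeff n = (\<integral>\<xi>. of_real (hermite_fun q n \<xi>) * f \<xi> \<partial>lebesgue_on (q_interval q))"

text \<open>
  As \<open>hermite_fun q n\<close> is real, real and imaginary parts of \<open>f\<close> can be treated separately.
\<close>

lemma bargmann_coeff_parseval: "(\<lambda>n. (cmod (bargmann_coeff n))\<^sup>2) sums (L2_norm q f)\<^sup>2"
proof -
  let ?M = "lebesgue_on (q_interval q)"
  have sq: "integrable ?M (\<lambda>\<xi>. (Re (f \<xi>))\<^sup>2)" "integrable ?M (\<lambda>\<xi>. (Im (f \<xi>))\<^sup>2)"
    by (rule Bochner_Integration.integrable_bound[OF L2_space_square_integrable]; simp add: cmod_power2)+
  have re: "Re (bargmann_coeff n) = (\<integral>\<xi>. hermite_fun q n \<xi> * Re (f \<xi>) \<partial>?M)"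
    and im: "Im (bargmann_coeff n) = (\<integral>\<xi>. hermite_fun q n \<xi> * Im (f \<xi>) \<partial>?M)" for n
    unfolding bargmann_coeff_def
    by (simp_all add: integral_Re[OF hermite_fun_L2_integrable(1), symmetric] integral_Im[OF hermite_fun_L2_integrable(1), symmetric])
  have "(\<lambda>n. (Re (bargmann_coeff n))\<^sup>2 + (Im (bargmann_coeff n))\<^sup>2) sums
     ((\<integral>\<xi>. (Re (f \<xi>))\<^sup>2 \<partial>?M) + (\<integral>\<xi>. (Im (f \<xi>))\<^sup>2 \<partial>?M))"
    unfolding re im by (intro sums_add hermite_fun_parseval[OF q] sq) measurable
  moreover have "(\<integral>\<xi>. (Re (f \<xi>))\<^sup>2 \<partial>?M) + (\<integral>\<xi>. (Im (f \<xi>))\<^sup>2 \<partial>?M) = (L2_norm q f)\<^sup>2"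
    using sq by (simp add: L2_norm_def cmod_power2)
  ultimately show ?thesis by (simp add: cmod_power2)
qed

lemma bargmann_expansion:
  assumes z: "z \<in> q_disc q"
  shows "integrable (lebesgue_on (q_interval q)) (\<lambda>\<xi>. q_bargmann_kernel q z \<xi> * f \<xi>)"
    and "(\<lambda>n. bargmann_coeff n * AC_basis q n z) sums q_bargmann q f z"
proof -
  let ?M = "lebesgue_on (q_interval q)"
  define F where "F n \<xi> = AC_basis q n z * (of_real (hermite_fun q n \<xi>) * f \<xi>)" for n \<xi>
  have Fint: "integrable ?M (F n)" for n
    unfolding F_def[abs_def] using hermite_fun_L2_integrable(1) by simp
  have sums: "(\<lambda>n. F n \<xi>) sums (q_bargmann_kernel q z \<xi> * f \<xi>)" if "\<xi> \<in> q_interval q" for \<xi>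
    using sums_mult2[OF bargmann_kernel_sums[OF q z that], of "f \<xi>"] by (simp add: F_def mult_ac)
  have norms: "summable (\<lambda>n. \<integral>\<xi>. norm (F n \<xi>) \<partial>?M)"
  proof (rule summable_comparison_test)
    define C where "C = 1 + (\<integral>\<xi>. (cmod (f \<xi>))\<^sup>2 \<partial>?M)"
    show "summable (\<lambda>n. cmod (AC_basis q n z) * C)" by (intro summable_mult2 summable_AC_basis q z)
    have "(\<integral>\<xi>. norm (F n \<xi>) \<partial>?M) \<le> cmod (AC_basis q n z) * C" for n
      using mult_left_mono[OF hermite_fun_L2_integrable(2)[of n], of "cmod (AC_basis q n z)"]
      by (simp add: F_def norm_mult C_def)
    then show "\<exists>N. \<forall>n\<ge>N. norm (\<integral>\<xi>. norm (F n \<xi>) \<partial>?M) \<le> cmod (AC_basis q n z) * C"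
      by (simp add: integral_nonneg_AE)
  qed
  have AEs: "AE \<xi> in ?M. summable (\<lambda>n. norm (F n \<xi>))"
  proof (rule AE_I2)
    fix \<xi> assume "\<xi> \<in> space ?M"
    then have "\<xi> \<in> q_interval q" by simp
    from summable_mult2[OF bargmann_kernel_summable[OF q z this], of "cmod (f \<xi>)"]
    show "summable (\<lambda>n. norm (F n \<xi>))" by (simp add: F_def norm_mult mult_ac)
  qed
  have eq: "(\<Sum>n. F n \<xi>) = q_bargmann_kernel q z \<xi> * f \<xi>" if "\<xi> \<in> space ?M" for \<xi>
    using sums_unique[OF sums] that by simp
  have "integrable ?M (\<lambda>\<xi>. \<Sum>n. F n \<xi>) \<longleftrightarrow> integrable ?M (\<lambda>\<xi>. q_bargmann_kernel q z \<xi> * f \<xi>)"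
    by (rule Bochner_Integration.integrable_cong[OF refl eq])
  with integrable_suminf[OF Fint AEs norms]
  show "integrable ?M (\<lambda>\<xi>. q_bargmann_kernel q z \<xi> * f \<xi>)" by blast
  have "(\<lambda>n. integral\<^sup>L ?M (F n)) sums (\<integral>\<xi>. (\<Sum>n. F n \<xi>) \<partial>?M)"
    by (rule sums_integral[OF Fint AEs norms])
  also have "(\<integral>\<xi>. (\<Sum>n. F n \<xi>) \<partial>?M) = q_bargmann q f z"
    unfolding q_bargmann_def by (rule Bochner_Integration.integral_cong[OF refl eq])
  finally show "(\<lambda>n. bargmann_coeff n * AC_basis q n z) sums q_bargmann q f z"
    by (simp add: F_def[abs_def] bargmann_coeff_def mult.commute)
qed

lemma bargmann_in_AC_space: "q_bargmann q f \<in> AC_space q"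
proof -
  have s: "summable (\<lambda>n. (cmod (bargmann_coeff n))\<^sup>2)"
    using bargmann_coeff_parseval by (rule sums_summable)
  have "q_bargmann q f holomorphic_on ball 0 (1 / sqrt (1 - q))"
  proof (rule power_series_holomorphic)
    fix w :: complex assume "w \<in> ball 0 (1 / sqrt (1 - q))"
    then have "(\<lambda>n. bargmann_coeff n * AC_basis q n w) sums q_bargmann q f w"
      using q by (intro bargmann_expansion) (simp add: q_disc_eq_ball)
    then show "(\<lambda>n. bargmann_coeff n / complex_of_real (sqrt (q_fact q n)) * (w - 0) ^ n) sums q_bargmann q f w"
      by (simp add: AC_basis_def)
  qed
  then show ?thesis
    using s bargmann_expansion(2) q by (auto simp: AC_space_def q_disc_eq_ball)
qed

lemma bargmann_norm: "AC_norm q (q_bargmann q f) = L2_norm q f"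
proof -
  have coord: "AC_coord q (q_bargmann q f) = bargmann_coeff"
    using bargmann_expansion(2) by (intro AC_coord_eqI q)
  have "AC_inner q (q_bargmann q f) (q_bargmann q f) = (\<Sum>n. complex_of_real ((cmod (bargmann_coeff n))\<^sup>2))"
    unfolding AC_inner_def coord complex_norm_square ..
  also have "\<dots> = complex_of_real ((L2_norm q f)\<^sup>2)"
    using sums_of_real[OF bargmann_coeff_parseval] by (rule sums_unique[symmetric])
  finally have "AC_norm q (q_bargmann q f) = sqrt ((L2_norm q f)\<^sup>2)" by (simp add: AC_norm_def)
  moreover have "L2_norm q f \<ge> 0" by (simp add: L2_norm_def)
  ultimately show ?thesis by simp
qed

end

theorem mainTheorem5:
  fixes q :: real
  assumes "0 < q" and "q < 1"
  shows "(\<forall>f\<in>L2_space q. \<forall>z\<in>q_disc q.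
            integrable (lebesgue_on (q_interval q)) (\<lambda>\<xi>. q_bargmann_kernel q z \<xi> * f \<xi>))
       \<and> (\<forall>f\<in>L2_space q. q_bargmann q f \<in> AC_space q)
       \<and> (\<forall>f\<in>L2_space q. \<forall>g\<in>L2_space q. \<forall>a b :: complex. \<forall>z\<in>q_disc q.
            q_bargmann q (\<lambda>\<xi>. a * f \<xi> + b * g \<xi>) z = a * q_bargmann q f z + b * q_bargmann q g z)
       \<and> (\<forall>f\<in>L2_space q. AC_norm q (q_bargmann q f) = L2_norm q f)"
proof (intro conjI ballI allI)
  fix f g :: "real \<Rightarrow> complex" and a b z :: complex
  assume fgz: "f \<in> L2_space q" "g \<in> L2_space q" "z \<in> q_disc q"
  have "q_bargmann q (\<lambda>\<xi>. a * f \<xi> + b * g \<xi>) z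
      = (\<integral>\<xi>. a * (q_bargmann_kernel q z \<xi> * f \<xi>) + b * (q_bargmann_kernel q z \<xi> * g \<xi>) \<partial>lebesgue_on (q_interval q))"
    unfolding q_bargmann_def by (intro Bochner_Integration.integral_cong refl) (simp add: algebra_simps)
  also have "\<dots> = a * q_bargmann q f z + b * q_bargmann q g z"
    using bargmann_expansion(1)[OF assms fgz(1,3)] bargmann_expansion(1)[OF assms fgz(2,3)]
    by (simp add: q_bargmann_def)
  finally show "q_bargmann q (\<lambda>\<xi>. a * f \<xi> + b * g \<xi>) z = a * q_bargmann q f z + b * q_bargmann q g z" .
qed (use assms in \<open>auto intro: bargmann_expansion(1) bargmann_in_AC_space bargmann_norm\<close>)

end
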